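(* Let $A$ generate a $C_0$-semigroup on the complex Hilbert space $H$, let $B\in\mathcal{L}(U,(\mathrm{dom}\,A^* )')$, and assume that for every $T>0$ the map $u\mapsto Lu$, $(Lu)(t)=\int_0^t e^{\mathcal{A}(t-s)}Bu(s)\,ds$, is linear and continuous from $L^2(0,T;U)$ into $L^2(0,T;H)$. Assume that there exist closed linear subspaces $H_s,H_1$ of $H$ such that: (1) $H=H_s\oplus H_1$; (2) $\lim_{t\to+\infty}e^{At}x=0$ for every $x\in H_s$; (3) $H_1$ is invariant for the semigroup $e^{At}$, and the set of all generalized eigenvectors of $A$ contained in $H_1$ is linearly dense in $H_1$ (here $H_1=\{0\}$ is allowed, and $H_1=\{0\}$ if $\sigma(A)=\emptyset$). Suppose furthermore that $s(A)\le 0$. If the system $\dot y=\mathcal{A}y+Bu$, $y(0)=y_0\in H$, is null controllable at some time $T>0$, then it is NCVE.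
   Context: Setting. $H$ is a complex Hilbert space with inner product $\langle\cdot,\cdot\rangle$ and norm $|\cdot|$; $A$ generates a $C_0$-semigroup $e^{At}$ on $H$; $A^*$ is its Hilbert space adjoint. The space $\mathrm{dom}\,A^*$ with the graph norm is a Hilbert space, not identified with its dual; $H$ is identified with its dual, so $\mathrm{dom}\,A^*\subset H=H'\subset(\mathrm{dom}\,A^* )'$ with continuous dense injections. $\mathcal{A}$ denotes the extension of $A$ to $(\mathrm{dom}\,A^* )'$ (the dual of $A^*\in\mathcal{L}(\mathrm{dom}\,A^*,H)$); its domain is $H$ and it generates a $C_0$-semigroup $e^{\mathcal{A}t}$ on $(\mathrm{dom}\,A^* )'$ extending $e^{At}$. $U$ is a Hilbert space. The solution of the system with initial state $y_0\in H$ and control $u\in L^2_{\rm loc}(0,+\infty;U)$ is $y^{y_0,u}(t)=e^{At}y_0+\int_0^t e^{\mathcal{A}(t-s)}Bu(s)\,ds$, which belongs to $L^2_{\rm loc}(0,+\infty;H)$ under the assumption on $L$. Definitions. $y_0\in H$ can be steered to the rest in time (at most) $T$ if there is a control $u\in L^2_{\rm loc}(0,+\infty;U)$ with support in $[0,T]$ such that $y^{y_0,u}$ has support in $[0,T]$ too. The system is null controllable in time $T$ if every $y_0\in H$ can be steered to the rest in time at most $T$. An element $y_0$ that can be steered to the rest is NCVE if for every $\epsilon>0$ there are a time $T_\epsilon$ and a control $u_\epsilon$ with support in $[0,T_\epsilon]$ steering $y_0$ to the rest in time at most $T_\epsilon$ with $\int_0^{+\infty}|u_\epsilon(s)|^2ds\le\epsilon^2$.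 The system is NCVE (null controllable with vanishing energy) if every element of $H$ is NCVE. A generalized eigenvector of $A$ associated to the eigenvalue $\lambda\in\mathbb{C}$ is an element of $\bigcup_{k\ge1}\mathrm{Ker}[(\lambda I-A)^k]$. The spectral bound is $s(A)=\sup\{\mathrm{Re}\,\lambda:\lambda\in\sigma(A)\}$, with $s(A)=-\infty$ if $\sigma(A)=\emptyset$. *)

theory Defs
  imports "HOL-Analysis.Analysis"
begin

section \<open>Complex Banach and Hilbert spaces\<close>

class scaleC =
  fixes scaleC :: "complex \<Rightarrow> 'a \<Rightarrow> 'a"  (infixr "*\<^sub>C" 75)

text \<open>The law \<open>1 *\<^sub>C x = x\<close> follows from \<open>scaleR_scaleC\<close>.\<close>

class complex_banach = banach + scaleC +
  assumes scaleC_add_right: "c *\<^sub>C (x + y) = c *\<^sub>C x + c *\<^sub>C y"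
    and scaleC_add_left: "(c + d) *\<^sub>C x = c *\<^sub>C x + d *\<^sub>C x"
    and scaleC_scaleC: "c *\<^sub>C d *\<^sub>C x = (c * d) *\<^sub>C x"
    and scaleR_scaleC: "r *\<^sub>R x = complex_of_real r *\<^sub>C x"
    and norm_scaleC: "norm (c *\<^sub>C x) = cmod c * norm x"

text \<open>The inner product is linear in the first argument and antilinear in the second.
  Separability is not required.\<close>

class complex_hilbert = complex_banach +
  fixes cinner :: "'a \<Rightarrow> 'a \<Rightarrow> complex"
  assumes cinner_add_left: "cinner (x + y) z = cinner x z + cinner y z"
    and cinner_scaleC_left: "cinner (c *\<^sub>C x) y = c * cinner x y"
    and cinner_commute: "cinner x y = cnj (cinner y x)"
    and cinner_self: "cinner x x = complex_of_real ((norm x)\<^sup>2)"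

instantiation complex :: complex_hilbert
begin
definition scaleC_complex :: "complex \<Rightarrow> complex \<Rightarrow> complex" where "scaleC_complex c x = c * x"
definition cinner_complex :: "complex \<Rightarrow> complex \<Rightarrow> complex" where "cinner_complex x y = x * cnj y"
instance
  by standard (auto simp: scaleC_complex_def cinner_complex_def algebra_simps
      norm_mult complex_norm_square[symmetric] scaleR_conv_of_real simp del: of_real_power)
end

definition csubspace :: "'a::complex_banach set \<Rightarrow> bool" where
  "csubspace V \<longleftrightarrow> 0 \<in> V \<and> (\<forall>x\<in>V. \<forall>y\<in>V. x + y \<in> V) \<and> (\<forall>c. \<forall>x\<in>V. c *\<^sub>C x \<in> V)"

definition cspan :: "'a::complex_banach set \<Rightarrow> 'a set" where
  "cspan X = csubspace hull X"

text \<open>The summands need not be orthogonal.\<close>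

definition is_direct_sum :: "'a::complex_banach set \<Rightarrow> 'a set \<Rightarrow> bool" where
  "is_direct_sum V W \<longleftrightarrow> V \<inter> W = {0} \<and> (\<forall>x. \<exists>v\<in>V. \<exists>w\<in>W. x = v + w)"

definition bounded_clinear :: "('a::complex_banach \<Rightarrow> 'b::complex_banach) \<Rightarrow> bool" where
  "bounded_clinear f \<longleftrightarrow> bounded_linear f \<and> (\<forall>c x. f (c *\<^sub>C x) = c *\<^sub>C f x)"


section \<open>The antidual of a complex Banach space\<close>

text \<open>Bounded antilinear functionals with the operator norm. For the inclusions
  \<open>dom A* \<subseteq> H = H' \<subseteq> (dom A*)'\<close> to be linear, with \<open>h \<in> H\<close> acting as \<open>\<lambda>d. \<langle>h, d\<rangle>\<close>,
  the prime has to denote the antidual.\<close>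

typedef (overloaded) 'a antidual =
  "{f :: 'a::complex_banach \<Rightarrow>\<^sub>L complex.
      \<forall>c x. blinfun_apply f (c *\<^sub>C x) = cnj c * blinfun_apply f x}"
  morphisms blinfun_of_antidual Antidual
  by (rule exI[of _ 0]) simp

setup_lifting type_definition_antidual

lift_definition antidual_apply :: "'a::complex_banach antidual \<Rightarrow> 'a \<Rightarrow> complex"
  is blinfun_apply .

instantiation antidual :: (complex_banach) real_normed_vector
begin

lift_definition zero_antidual :: "'a antidual" is 0 by simp
lift_definition plus_antidual :: "'a antidual \<Rightarrow> 'a antidual \<Rightarrow> 'a antidual" is "(+)"
  by (simp add: blinfun.add_left algebra_simps)
lift_definition minus_antidual :: "'a antidual \<Rightarrow> 'a antidual \<Rightarrow> 'a antidual" is "(-)"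
  by (simp add: blinfun.diff_left algebra_simps)
lift_definition uminus_antidual :: "'a antidual \<Rightarrow> 'a antidual" is uminus
  by (simp add: blinfun.minus_left)
lift_definition scaleR_antidual :: "real \<Rightarrow> 'a antidual \<Rightarrow> 'a antidual" is scaleR
  by (simp add: blinfun.scaleR_left)
lift_definition norm_antidual :: "'a antidual \<Rightarrow> real" is norm .

definition dist_antidual :: "'a antidual \<Rightarrow> 'a antidual \<Rightarrow> real"
  where "dist_antidual f g = norm (f - g)"
definition sgn_antidual :: "'a antidual \<Rightarrow> 'a antidual"
  where "sgn_antidual f = inverse (norm f) *\<^sub>R f"
definition uniformity_antidual :: "('a antidual \<times> 'a antidual) filter"
  where "uniformity_antidual = (INF e\<in>{0<..}. principal {(f, g). dist f g < e})"
definition open_antidual :: "'a antidual set \<Rightarrow> bool"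
  where "open_antidual S = (\<forall>f\<in>S. \<forall>\<^sub>F (f', g) in uniformity. f' = f \<longrightarrow> g \<in> S)"

instance
proof
  fix f g :: "'a antidual" and c :: real
  show "(norm f = 0) = (f = 0)" by transfer simp
  show "norm (f + g) \<le> norm f + norm g" by transfer (rule norm_triangle_ineq)
  show "norm (c *\<^sub>R f) = \<bar>c\<bar> * norm f" by transfer simp
qed (rule dist_antidual_def sgn_antidual_def uniformity_antidual_def
       open_antidual_def
     | (transfer, simp add: algebra_simps))+

end

instantiation antidual :: (complex_banach) complex_banach
begin

lift_definition scaleC_antidual :: "complex \<Rightarrow> 'a antidual \<Rightarrow> 'a antidual"
  is "\<lambda>c f. blinfun_compose (blinfun_mult_right c) f"
  by simp

instance
proof
  fix f g :: "'a antidual" and c d :: complex and r :: real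
  show "c *\<^sub>C (f + g) = c *\<^sub>C f + c *\<^sub>C g"
    by transfer (auto intro!: blinfun_eqI simp: blinfun.add_left algebra_simps)
  show "(c + d) *\<^sub>C f = c *\<^sub>C f + d *\<^sub>C f"
    by transfer (auto intro!: blinfun_eqI simp: blinfun.add_left algebra_simps)
  show "c *\<^sub>C d *\<^sub>C f = (c * d) *\<^sub>C f"
    by transfer (auto intro!: blinfun_eqI simp: algebra_simps)
  show "r *\<^sub>R f = complex_of_real r *\<^sub>C f"
    by transfer (auto intro!: blinfun_eqI simp: blinfun.scaleR_left scaleR_conv_of_real)
  show "norm (c *\<^sub>C f) = cmod c * norm f"
  proof transfer
    fix c and f :: "'a \<Rightarrow>\<^sub>L complex"
    have comp: "blinfun_apply (blinfun_mult_right c o\<^sub>L f) = (\<lambda>x. c * blinfun_apply f x)"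
      by auto
    have "onorm (\<lambda>x. c * blinfun_apply f x) = cmod c * onorm (blinfun_apply f)"
    proof (cases "c = 0")
      case False
      have le: "onorm (\<lambda>x. a * blinfun_apply g x) \<le> cmod a * onorm (blinfun_apply g)"
        for a and g :: "'a \<Rightarrow>\<^sub>L complex"
      proof (rule onorm_bound)
        show "cmod (a * blinfun_apply g x) \<le> cmod a * onorm (blinfun_apply g) * norm x" for x
          using onorm[OF blinfun.bounded_linear_right, of g x]
          by (simp add: norm_mult mult.assoc mult_left_mono)
      qed (simp add: onorm_pos_le blinfun.bounded_linear_right)
      have "onorm (\<lambda>x. inverse c * blinfun_apply (blinfun_mult_right c o\<^sub>L f) x)
          \<le> cmod (inverse c) * onorm (blinfun_apply (blinfun_mult_right c o\<^sub>L f))"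
        by (rule le)
      then have "onorm (blinfun_apply f) \<le> inverse (cmod c) * onorm (\<lambda>x. c * blinfun_apply f x)"
        using False by (simp add: norm_inverse mult.assoc[symmetric] comp)
      then have "cmod c * onorm (blinfun_apply f) \<le> onorm (\<lambda>x. c * blinfun_apply f x)"
        using False by (simp add: field_simps)
      with le[of c f] show ?thesis by simp
    qed (simp add: onorm_zero)
    then show "norm (blinfun_mult_right c o\<^sub>L f) = cmod c * norm f"
      by (simp add: norm_blinfun.rep_eq comp)
  qed
next
  show "convergent X" if "Cauchy X" for X :: "nat \<Rightarrow> 'a antidual"
  proof -
    have dist_eq: "dist f g = dist (blinfun_of_antidual f) (blinfun_of_antidual g)"
      for f g :: "'a antidual"
      by (simp add: dist_antidual_def norm_antidual.rep_eq minus_antidual.rep_eq dist_norm)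
    have "Cauchy (\<lambda>n. blinfun_of_antidual (X n))"
      using that by (simp add: Cauchy_def dist_eq)
    then obtain F where F: "(\<lambda>n. blinfun_of_antidual (X n)) \<longlonglongrightarrow> F"
      by (auto simp: Cauchy_convergent_iff convergent_def)
    have "blinfun_apply F (c *\<^sub>C x) = cnj c * blinfun_apply F x" for c x
    proof (rule LIMSEQ_unique)
      show "(\<lambda>n. blinfun_of_antidual (X n) (c *\<^sub>C x)) \<longlonglongrightarrow> F (c *\<^sub>C x)"
        by (intro blinfun.tendsto F tendsto_const)
      have "blinfun_of_antidual (X n) (c *\<^sub>C x) = cnj c * blinfun_of_antidual (X n) x" for n
        using blinfun_of_antidual[of "X n"] by blast
      then show "(\<lambda>n. blinfun_of_antidual (X n) (c *\<^sub>C x)) \<longlonglongrightarrow> cnj c * F x"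
        by (auto intro!: tendsto_mult blinfun.tendsto F tendsto_const)
    qed
    then have "blinfun_of_antidual (Antidual F) = F"
      by (simp add: Antidual_inverse)
    with F have "(\<lambda>n. dist (X n) (Antidual F)) \<longlonglongrightarrow> 0"
      by (simp add: dist_eq tendsto_dist_iff[symmetric])
    then have "\<forall>e>0. \<exists>N. \<forall>n\<ge>N. dist (X n) (Antidual F) < e"
      by (auto simp: LIMSEQ_def dist_real_def)
    then show ?thesis
      unfolding convergent_def LIMSEQ_def by blast
  qed
qed

end


section \<open>Unbounded operators, spectrum, and semigroups\<close>

text \<open>An unbounded operator is represented by its graph, a set of pairs \<open>(x, A x)\<close> with
  \<open>x \<in> dom A = Domain A\<close>.\<close>

type_synonym 'a op_graph = "('a \<times> 'a) set"

definition shifted_op :: "complex \<Rightarrow> 'a::complex_banach op_graph \<Rightarrow> 'a op_graph" where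
  "shifted_op \<mu> A = {(x, \<mu> *\<^sub>C x - y) | x y. (x, y) \<in> A}"

definition op_ker :: "'a::complex_banach op_graph \<Rightarrow> 'a set" where
  "op_ker A = {x. (x, 0) \<in> A}"

definition resolvent_set :: "'a::complex_banach op_graph \<Rightarrow> complex set" where
  "resolvent_set A = {\<mu>. \<exists>R. bounded_clinear R \<and> (shifted_op \<mu> A)\<inverse> = {(y, R y) | y. True}}"

definition spectrum :: "'a::complex_banach op_graph \<Rightarrow> complex set" where
  "spectrum A = - resolvent_set A"

text \<open>In the extended reals the supremum of the empty set is \<open>-\<infinity>\<close>.\<close>

definition spectral_bound :: "'a::complex_banach op_graph \<Rightarrow> ereal" where
  "spectral_bound A = (SUP \<mu>\<in>spectrum A. ereal (Re \<mu>))"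

definition eigenvalue :: "'a::complex_banach op_graph \<Rightarrow> complex \<Rightarrow> bool" where
  "eigenvalue A \<mu> \<longleftrightarrow> (\<exists>x\<in>op_ker (shifted_op \<mu> A). x \<noteq> 0)"

definition generalized_eigenvectors :: "'a::complex_banach op_graph \<Rightarrow> 'a set" where
  "generalized_eigenvectors A =
     {x. \<exists>\<mu>. eigenvalue A \<mu> \<and> (\<exists>k\<ge>1. x \<in> op_ker (shifted_op \<mu> A ^^ k))}"

text \<open>Semigroups are indexed by all of \<open>real\<close>; their values at negative times are irrelevant.\<close>

definition c0_semigroup :: "(real \<Rightarrow> 'a::complex_banach \<Rightarrow> 'a) \<Rightarrow> bool" where
  "c0_semigroup S \<longleftrightarrow>
     (\<forall>t\<ge>0. bounded_clinear (S t)) \<and>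
     S 0 = id \<and>
     (\<forall>s\<ge>0. \<forall>t\<ge>0. S (s + t) = S s \<circ> S t) \<and>
     (\<forall>x. ((\<lambda>t. S t x) \<longlongrightarrow> x) (at_right 0))"

definition generator :: "(real \<Rightarrow> 'a::complex_banach \<Rightarrow> 'a) \<Rightarrow> 'a op_graph" where
  "generator S = {(x, y). ((\<lambda>t. (S t x - x) /\<^sub>R t) \<longlongrightarrow> y) (at_right 0)}"

definition generates :: "'a::complex_banach op_graph \<Rightarrow> (real \<Rightarrow> 'a \<Rightarrow> 'a) \<Rightarrow> bool" where
  "generates A S \<longleftrightarrow> c0_semigroup S \<and> generator S = A"

definition adjoint_op :: "'a::complex_hilbert op_graph \<Rightarrow> 'a op_graph" where
  "adjoint_op A = {(y, z). \<forall>(x, w)\<in>A. cinner w y = cinner x z}"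


section \<open>The extrapolation space\<close>

text \<open>A domain of an operator is a set, not a type. The Hilbert space \<open>dom T\<close> with the graph norm
  is therefore given as a type \<open>'d\<close> together with its inclusion \<open>j\<close> into \<open>H\<close>; by polarization,
  the norm determines the inner product. A copy of \<open>H\<close> itself can always serve as \<open>'d\<close> if \<open>T\<close> is
  closed with nonempty resolvent set, because \<open>dom T\<close> is then linearly homeomorphic to
  \<open>H\<close> and hence has the same Hilbert dimension.\<close>

definition is_graph_space ::
  "'h::complex_hilbert op_graph \<Rightarrow> ('d::complex_hilbert \<Rightarrow> 'h) \<Rightarrow> bool" where
  "is_graph_space T j \<longleftrightarrow>
     (\<forall>d e. j (d + e) = j d + j e) \<and>
     (\<forall>c d. j (c *\<^sub>C d) = c *\<^sub>C j d) \<and>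
     range j = Domain T \<and>
     (\<forall>d w. (j d, w) \<in> T \<longrightarrow> norm d = sqrt ((norm (j d))\<^sup>2 + (norm w)\<^sup>2))"

text \<open>The inclusion of \<open>H\<close> into \<open>(dom A*)'\<close>; meaningful for bounded complex linear \<open>j\<close>.\<close>

definition embed :: "('d::complex_hilbert \<Rightarrow> 'h::complex_hilbert) \<Rightarrow> 'h \<Rightarrow> 'd antidual" where
  "embed j h = Antidual (Blinfun (\<lambda>d. cinner h (j d)))"

text \<open>The operator \<open>\<A>\<close> with domain \<open>H\<close>, dual to \<open>A* : dom A* \<rightarrow> H\<close>:
  \<open>(\<A> h)(d) = \<langle>h, A* d\<rangle>\<close>.\<close>

definition extended_op ::
  "'h::complex_hilbert op_graph \<Rightarrow> ('d::complex_hilbert \<Rightarrow> 'h) \<Rightarrow> 'd antidual op_graph" where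
  "extended_op A j =
     {(embed j h, f) | h f. \<forall>d w. (j d, w) \<in> adjoint_op A \<longrightarrow> antidual_apply f d = cinner h w}"


section \<open>Bochner integral and square integrable functions\<close>

text \<open>The Bochner integral of the library is restricted to second countable spaces.
  The following definitions do without this restriction.\<close>

definition strongly_measurable :: "'a measure \<Rightarrow> ('a \<Rightarrow> 'b::real_normed_vector) \<Rightarrow> bool" where
  "strongly_measurable M f \<longleftrightarrow>
     (\<exists>s. (\<forall>i::nat. simple_function M (s i)) \<and> (AE x in M. (\<lambda>i. s i x) \<longlonglongrightarrow> f x))"

definition has_strong_integral ::
  "'a measure \<Rightarrow> ('a \<Rightarrow> 'b::real_normed_vector) \<Rightarrow> 'b \<Rightarrow> bool" where
  "has_strong_integral M f I \<longleftrightarrow>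
     strongly_measurable M f \<and>
     (\<exists>s. (\<forall>i::nat. Bochner_Integration.simple_bochner_integrable M (s i)) \<and>
          (\<lambda>i. \<integral>\<^sup>+x. ennreal (norm (f x - s i x)) \<partial>M) \<longlonglongrightarrow> 0 \<and>
          (\<lambda>i. Bochner_Integration.simple_bochner_integral M (s i)) \<longlonglongrightarrow> I)"

definition L2_on :: "real \<Rightarrow> (real \<Rightarrow> 'b::real_normed_vector) set" where
  "L2_on T = {u. strongly_measurable (lebesgue_on {0..T}) u \<and>
                 integrable (lebesgue_on {0..T}) (\<lambda>t. (norm (u t))\<^sup>2)}"

definition L2_norm :: "real \<Rightarrow> (real \<Rightarrow> 'b::real_normed_vector) \<Rightarrow> real" where
  "L2_norm T u = sqrt (\<integral>t. (norm (u t))\<^sup>2 \<partial>lebesgue_on {0..T})"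

definition L2_loc :: "(real \<Rightarrow> 'b::real_normed_vector) set" where
  "L2_loc = {u. \<forall>T>0. u \<in> L2_on T}"

definition energy :: "(real \<Rightarrow> 'b::real_normed_vector) \<Rightarrow> ennreal" where
  "energy u = (\<integral>\<^sup>+t. ennreal ((norm (u t))\<^sup>2) \<partial>lebesgue_on {0..})"

text \<open>Support in \<open>[0,T]\<close> for (classes of) functions on the half line.\<close>

definition supported_in :: "real \<Rightarrow> (real \<Rightarrow> 'b::real_normed_vector) \<Rightarrow> bool" where
  "supported_in T u \<longleftrightarrow> (AE t in lebesgue_on {0..}. t > T \<longrightarrow> u t = 0)"


section \<open>The control system\<close>

text \<open>Below, \<open>S\<close> is \<open>exp(At)\<close> on \<open>'h\<close>, \<open>Se\<close> is \<open>exp(\<A>t)\<close> on \<open>'d antidual\<close>, and \<open>j\<close> is the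
  inclusion of \<open>'d = dom A*\<close> into \<open>'h\<close>. The predicate \<open>has_input_value Se B u t v\<close> says that
  the integral defining \<open>(Lu)(t)\<close>, which is taken in \<open>(dom A*)'\<close>, has value \<open>v\<close>.\<close>

definition has_input_value ::
  "(real \<Rightarrow> 'd antidual \<Rightarrow> 'd antidual) \<Rightarrow> ('u \<Rightarrow> 'd antidual) \<Rightarrow>
   (real \<Rightarrow> 'u) \<Rightarrow> real \<Rightarrow> 'd::complex_hilbert antidual \<Rightarrow> bool" where
  "has_input_value Se B u t v \<longleftrightarrow>
     has_strong_integral (lebesgue_on {0..t}) (\<lambda>s. Se (t - s) (B (u s))) v"

text \<open>\<open>L\<close> maps \<open>L\<^sup>2(0,T;U)\<close> boundedly into \<open>L\<^sup>2(0,T;H)\<close>. The function \<open>g = Lu\<close> is determined by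
  \<open>u\<close> up to null sets, and \<open>L\<close> is linear because \<open>B\<close>, \<open>Se\<close> and the integral are.\<close>

definition L_continuous ::
  "('d::complex_hilbert \<Rightarrow> 'h::complex_hilbert) \<Rightarrow> (real \<Rightarrow> 'd antidual \<Rightarrow> 'd antidual) \<Rightarrow>
   ('u::complex_hilbert \<Rightarrow> 'd antidual) \<Rightarrow> real \<Rightarrow> bool" where
  "L_continuous j Se B T \<longleftrightarrow>
     (\<exists>C. \<forall>u\<in>L2_on T. \<exists>g\<in>L2_on T.
        (AE t in lebesgue_on {0..T}. has_input_value Se B u t (embed j (g t))) \<and>
        L2_norm T g \<le> C * L2_norm T u)"

definition is_solution ::
  "(real \<Rightarrow> 'h \<Rightarrow> 'h) \<Rightarrow> ('d::complex_hilbert \<Rightarrow> 'h::complex_hilbert) \<Rightarrow>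
   (real \<Rightarrow> 'd antidual \<Rightarrow> 'd antidual) \<Rightarrow> ('u::complex_hilbert \<Rightarrow> 'd antidual) \<Rightarrow>
   'h \<Rightarrow> (real \<Rightarrow> 'u) \<Rightarrow> (real \<Rightarrow> 'h) \<Rightarrow> bool" where
  "is_solution S j Se B y0 u y \<longleftrightarrow>
     y \<in> L2_loc \<and>
     (AE t in lebesgue_on {0..}.
        \<exists>v. has_input_value Se B u t v \<and> embed j (y t) = embed j (S t y0) + v)"

definition steers_to_rest ::
  "(real \<Rightarrow> 'h \<Rightarrow> 'h) \<Rightarrow> ('d::complex_hilbert \<Rightarrow> 'h::complex_hilbert) \<Rightarrow>
   (real \<Rightarrow> 'd antidual \<Rightarrow> 'd antidual) \<Rightarrow> ('u::complex_hilbert \<Rightarrow> 'd antidual) \<Rightarrow>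
   real \<Rightarrow> 'h \<Rightarrow> (real \<Rightarrow> 'u) \<Rightarrow> bool" where
  "steers_to_rest S j Se B T y0 u \<longleftrightarrow>
     u \<in> L2_loc \<and> supported_in T u \<and>
     (\<exists>y. is_solution S j Se B y0 u y \<and> supported_in T y)"

definition null_controllable ::
  "(real \<Rightarrow> 'h \<Rightarrow> 'h) \<Rightarrow> ('d::complex_hilbert \<Rightarrow> 'h::complex_hilbert) \<Rightarrow>
   (real \<Rightarrow> 'd antidual \<Rightarrow> 'd antidual) \<Rightarrow> ('u::complex_hilbert \<Rightarrow> 'd antidual) \<Rightarrow>
   real \<Rightarrow> bool" where
  "null_controllable S j Se B T \<longleftrightarrow> (\<forall>y0. \<exists>u. steers_to_rest S j Se B T y0 u)"

definition NCVE_element ::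
  "(real \<Rightarrow> 'h \<Rightarrow> 'h) \<Rightarrow> ('d::complex_hilbert \<Rightarrow> 'h::complex_hilbert) \<Rightarrow>
   (real \<Rightarrow> 'd antidual \<Rightarrow> 'd antidual) \<Rightarrow> ('u::complex_hilbert \<Rightarrow> 'd antidual) \<Rightarrow>
   'h \<Rightarrow> bool" where
  "NCVE_element S j Se B y0 \<longleftrightarrow>
     (\<exists>T>0. \<exists>u. steers_to_rest S j Se B T y0 u) \<and>
     (\<forall>\<epsilon>>0. \<exists>T>0. \<exists>u. steers_to_rest S j Se B T y0 u \<and> energy u \<le> ennreal (\<epsilon>\<^sup>2))"

definition NCVE ::
  "(real \<Rightarrow> 'h \<Rightarrow> 'h) \<Rightarrow> ('d::complex_hilbert \<Rightarrow> 'h::complex_hilbert) \<Rightarrow>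
   (real \<Rightarrow> 'd antidual \<Rightarrow> 'd antidual) \<Rightarrow> ('u::complex_hilbert \<Rightarrow> 'd antidual) \<Rightarrow> bool" where
  "NCVE S j Se B \<longleftrightarrow> (\<forall>y0. NCVE_element S j Se B y0)"

end

theory Submission
  imports Defs
begin

text \<open>
  Let \<open>cost x\<close> be the infimum of the energies of all controls steering \<open>x\<close> to the rest in some
  finite time. A Baire category argument turns null controllability into a bound
  \<open>cost x \<le> C |x|\<^sup>2\<close>, and \<open>cost\<close> behaves like the square of a seminorm, so its null set \<open>N\<close> is a
  closed subspace; the system is NCVE iff \<open>N\<close> is everything. Waiting for a time \<open>t\<close> before
  acting gives \<open>cost x \<le> cost (S t x)\<close>, hence \<open>Hs \<subseteq> N\<close>. If \<open>u\<close> steers \<open>x\<close> to the rest at time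
  \<open>T\<close> with energy \<open>E\<close>, then applying \<open>\<epsilon> u\<close> first yields
  \<open>cost x \<le> \<epsilon>\<^sup>2 E + (1 - \<epsilon>)\<^sup>2 cost (S T x)\<close>. For \<open>x\<close> in \<open>Ker (\<mu> - A)^k\<close> with \<open>Re \<mu> \<le> 0\<close>,
  induction on \<open>k\<close> shows that \<open>S T x\<close> agrees with \<open>exp (\<mu> T) x\<close> modulo \<open>N\<close>, so
  \<open>cost (S T x) \<le> cost x\<close>; letting \<open>\<epsilon>\<close> tend to \<open>0\<close> gives \<open>cost x = 0\<close>.
\<close>

section \<open>Strongly measurable functions\<close>

text \<open>Null controllability supplies some control for each state, with neither a linear choice
  nor a bound. The Baire argument therefore concerns the set of states that can be steered in a
  fixed time with energy at most 1. Closedness of this set under weighted series takes the place of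
  a closed graph argument. The obstacle is that steering is a condition at almost every time, while
  evaluating \<open>L u\<close> at a time is in general not continuous in \<open>u\<close>;
  geometric weights turn L2 bounds on remainders into convergence almost everywhere.
  \<open>cost\<close> is quadratic, so sums are estimated by (1 + \<delta>) p^2 + (1 + 1/\<delta>)
  q^2 with free \<delta>. This avoids square roots and lets one coefficient approach 1, which is
  what working modulo N needs. The inequality \<open>cost x \<le> cost (S t x)\<close> does not show
  that the semigroup maps N into itself. The induction on k therefore needs the whole orbit of
  (\<mu> - A) x in N, and gets it from the invariance of the kernels. In the last step, using a
  fraction \<epsilon> of the control costs order \<epsilon>^2 but saves order \<epsilon>.\<close>

lemma complete_measure_lebesgue_on:
  assumes "A \<in> sets lebesgue"
  shows "complete_measure (lebesgue_on A)"
proof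
  fix X Y assume "Y \<subseteq> X" "X \<in> null_sets (lebesgue_on A)"
  with assms have "X \<in> null_sets lebesgue" "Y \<subseteq> A"
    by (auto simp: null_sets_restrict_space)
  with \<open>Y \<subseteq> X\<close> have "Y \<in> null_sets lebesgue"
    by (metis null_sets_completion_subset)
  with \<open>Y \<subseteq> A\<close> assms show "Y \<in> sets (lebesgue_on A)"
    by (auto simp: sets_restrict_space_iff)
qed

text \<open>Preimages under \<open>f\<close> and \<open>g\<close> differ only inside a null set, and
  completeness makes such differences measurable.\<close>

lemma (in complete_measure) measurable_cong_AE_complete:
  assumes f: "f \<in> measurable M N" and g: "g \<in> space M \<rightarrow> space N" and ae: "AE x in M. f x = g x"
  shows "g \<in> measurable M N"
proof (rule measurableI)
  fix A assume A: "A \<in> sets N"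
  have fA: "f -` A \<inter> space M \<in> sets M"
    using f A by (rule measurable_sets)
  show "g -` A \<inter> space M \<in> sets M"
    using ae by (intro in_sets_AE[OF _ fA]) (auto elim!: AE_mp)
qed (use g in auto)

lemma (in complete_measure) borel_measurable_cong_AE:
  "f \<in> borel_measurable M \<Longrightarrow> AE x in M. f x = g x \<Longrightarrow> g \<in> borel_measurable M"
  by (rule measurable_cong_AE_complete) auto

text \<open>Sequential continuity of \<open>h\<close> is enough because \<open>h\<close> is applied
  to the simple approximants themselves. Maps of one argument are covered by ignoring the
  other.\<close>

lemma strongly_measurable_compose2:
  assumes "strongly_measurable M f" "strongly_measurable M g"
    and h: "\<And>a b x y. a \<longlonglongrightarrow> x \<Longrightarrow> b \<longlonglongrightarrow> y \<Longrightarrow> (\<lambda>i. h (a i) (b i)) \<longlonglongrightarrow> h x y"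
  shows "strongly_measurable M (\<lambda>x. h (f x) (g x))"
proof -
  from assms(1) obtain s where s: "\<And>i::nat. simple_function M (s i)"
    and lim: "AE x in M. (\<lambda>i. s i x) \<longlonglongrightarrow> f x"
    unfolding strongly_measurable_def by blast
  from assms(2) obtain r where r: "\<And>i::nat. simple_function M (r i)"
    and lim': "AE x in M. (\<lambda>i. r i x) \<longlonglongrightarrow> g x"
    unfolding strongly_measurable_def by blast
  from lim lim' have "AE x in M. (\<lambda>i. h (s i x) (r i x)) \<longlonglongrightarrow> h (f x) (g x)"
    by eventually_elim (rule h)
  moreover have "simple_function M (\<lambda>x. h (s i x) (r i x))" for i
    by (rule simple_function_compose2[OF s r])
  ultimately show ?thesis
    unfolding strongly_measurable_def by (intro exI[of _ "\<lambda>i x. h (s i x) (r i x)"]) auto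
qed

lemma strongly_measurable_add:
  "strongly_measurable M f \<Longrightarrow> strongly_measurable M g \<Longrightarrow> strongly_measurable M (\<lambda>x. f x + g x)"
  by (rule strongly_measurable_compose2[where h="(+)"]) (auto intro: tendsto_add)

lemma strongly_measurable_diff:
  "strongly_measurable M f \<Longrightarrow> strongly_measurable M g \<Longrightarrow> strongly_measurable M (\<lambda>x. f x - g x)"
  by (rule strongly_measurable_compose2[where h="(-)"]) (auto intro: tendsto_diff)

lemma strongly_measurable_bounded_linear:
  "bounded_linear h \<Longrightarrow> strongly_measurable M f \<Longrightarrow> strongly_measurable M (\<lambda>x. h (f x))"
  by (rule strongly_measurable_compose2[where h="\<lambda>x _. h x"]) (auto intro: bounded_linear.tendsto)

lemma strongly_measurable_zero: "strongly_measurable M (\<lambda>x. 0)"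
  unfolding strongly_measurable_def by (rule exI[of _ "\<lambda>_ _. 0"]) auto

lemma strongly_measurable_norm:
  "strongly_measurable M f \<Longrightarrow> strongly_measurable M (\<lambda>x. norm (f x))"
  by (rule strongly_measurable_compose2[where h="\<lambda>x _. norm x"]) (auto intro: tendsto_norm)

text \<open>Set to 0 on the exceptional null set, the simple approximants converge everywhere;
  completeness then restores \<open>f\<close> on that set.\<close>

lemma (in complete_measure) strongly_measurable_imp_borel:
  assumes "strongly_measurable M f"
  shows "f \<in> borel_measurable M"
proof -
  from assms obtain s where s: "\<And>i::nat. simple_function M (s i)"
    and lim: "AE x in M. (\<lambda>i. s i x) \<longlonglongrightarrow> f x"
    unfolding strongly_measurable_def by blast
  define N where "N = {x \<in> space M. \<not> (\<lambda>i. s i x) \<longlonglongrightarrow> f x}"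
  have N: "N \<in> null_sets M" using lim unfolding N_def AE_iff_null_sets .
  have "(\<lambda>x. if x \<in> N then 0 else f x) \<in> borel_measurable M"
  proof (rule borel_measurable_LIMSEQ_metric)
    fix i
    have "simple_function M (\<lambda>x. if x \<in> N then 0 else s i x)"
      using N s by (intro simple_function_If_set) auto
    then show "(\<lambda>x. if x \<in> N then 0 else s i x) \<in> borel_measurable M"
      by (rule borel_measurable_simple_function)
  qed (auto simp: N_def)
  moreover have "AE x in M. (if x \<in> N then 0 else f x) = f x"
    using AE_not_in[OF N] by eventually_elim auto
  ultimately show ?thesis by (rule borel_measurable_cong_AE)
qed

lemma (in complete_measure) strongly_measurable_imp_borel_norm:
  "strongly_measurable M f \<Longrightarrow> (\<lambda>x. norm (f x)) \<in> borel_measurable M"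
  by (intro strongly_measurable_imp_borel strongly_measurable_norm)

text \<open>The approximants are chosen with \<open>\<integral> min 1 |s n - u n| \<le> 1/2^n\<close>; the sum of these
  integrals being finite, \<open>s n - u n\<close> tends to \<open>0\<close> almost everywhere.\<close>

lemma (in complete_measure) strongly_measurable_LIMSEQ:
  assumes fin: "emeasure M (space M) < \<infinity>"
    and u: "\<And>n::nat. strongly_measurable M (u n)"
    and lim: "AE x in M. (\<lambda>n. u n x) \<longlonglongrightarrow> f x"
  shows "strongly_measurable M f"
proof -
  have "\<exists>s. simple_function M s \<and> (\<lambda>x. norm (s x - u n x)) \<in> borel_measurable M \<and>
      (\<integral>\<^sup>+x. ennreal (min 1 (norm (s x - u n x))) \<partial>M) \<le> ennreal ((1/2)^n)" for n
  proof -
    from u[of n] obtain s where s: "\<And>i::nat. simple_function M (s i)"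
      and lim: "AE x in M. (\<lambda>i. s i x) \<longlonglongrightarrow> u n x"
      unfolding strongly_measurable_def by blast
    have "strongly_measurable M (s i)" for i
      unfolding strongly_measurable_def using s by (intro exI[of _ "\<lambda>_. s i"]) auto
    then have "strongly_measurable M (\<lambda>x. s i x - u n x)" for i
      using u by (rule strongly_measurable_diff)
    then have [measurable]: "(\<lambda>x. norm (s i x - u n x)) \<in> borel_measurable M" for i
      by (rule strongly_measurable_imp_borel_norm)
    \<comment> \<open>Truncation at 1 provides an integrable majorant, the measure being finite; the
      distances themselves need not be integrable.\<close>
    have "(\<lambda>i. \<integral>\<^sup>+x. ennreal (min 1 (norm (s i x - u n x))) \<partial>M) \<longlonglongrightarrow> (\<integral>\<^sup>+x. 0 \<partial>M)"
    proof (rule nn_integral_dominated_convergence[where w="\<lambda>x. 1"])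
      show "AE x in M. (\<lambda>i. ennreal (min 1 (norm (s i x - u n x)))) \<longlonglongrightarrow> 0"
        using lim
      proof eventually_elim
        case (elim x)
        then have "(\<lambda>i. min 1 (norm (s i x - u n x))) \<longlonglongrightarrow> min 1 0"
          by (intro tendsto_min tendsto_const tendsto_norm_zero) (simp add: LIM_zero)
        from tendsto_ennrealI[OF this] show ?case by simp
      qed
    qed (use fin in \<open>auto simp: ennreal_le_1\<close>)
    then have "\<forall>\<^sub>F i in sequentially. (\<integral>\<^sup>+x. ennreal (min 1 (norm (s i x - u n x))) \<partial>M) < ennreal ((1/2)^n)"
      by (rule order_tendstoD) simp
    then obtain i where "(\<integral>\<^sup>+x. ennreal (min 1 (norm (s i x - u n x))) \<partial>M) < ennreal ((1/2)^n)"
      by (auto simp: eventually_sequentially)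
    then show ?thesis using s[of i] by (intro exI[of _ "s i"]) auto
  qed
  then obtain s where s: "\<And>n. simple_function M (s n)"
    and [measurable]: "\<And>n. (\<lambda>x. norm (s n x - u n x)) \<in> borel_measurable M"
    and le: "\<And>n. (\<integral>\<^sup>+x. ennreal (min 1 (norm (s n x - u n x))) \<partial>M) \<le> ennreal ((1/2)^n)"
    by metis
  have "(\<integral>\<^sup>+x. (\<Sum>n. ennreal (min 1 (norm (s n x - u n x)))) \<partial>M)
      = (\<Sum>n. \<integral>\<^sup>+x. ennreal (min 1 (norm (s n x - u n x))) \<partial>M)"
    by (intro nn_integral_suminf) measurable
  also have "\<dots> \<le> (\<Sum>n. ennreal ((1/2)^n))"
    by (intro suminf_le le summableI)
  also have "\<dots> = ennreal (\<Sum>n. (1/2)^n)"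
    by (intro suminf_ennreal2) (auto intro: summable_geometric)
  finally have "(\<integral>\<^sup>+x. (\<Sum>n. ennreal (min 1 (norm (s n x - u n x)))) \<partial>M) \<noteq> \<infinity>"
    by (auto simp: top_unique)
  then have "AE x in M. (\<Sum>n. ennreal (min 1 (norm (s n x - u n x)))) \<noteq> \<infinity>"
    by (intro nn_integral_PInf_AE) measurable
  with lim have "AE x in M. (\<lambda>n. s n x) \<longlonglongrightarrow> f x"
  proof eventually_elim
    case (elim x)
    have "summable (\<lambda>n. min 1 (norm (s n x - u n x)))"
      using elim(2) by (intro summable_suminf_not_top) auto
    then have "(\<lambda>n. min 1 (norm (s n x - u n x))) \<longlonglongrightarrow> 0" by (rule summable_LIMSEQ_zero)
    moreover from this have "\<forall>\<^sub>F n in sequentially. min 1 (norm (s n x - u n x)) < 1"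
      by (rule order_tendstoD) simp
    \<comment> \<open>A truncated distance below 1 is the distance itself.\<close>
    then have "\<forall>\<^sub>F n in sequentially. min 1 (norm (s n x - u n x)) = norm (s n x - u n x)"
      by eventually_elim auto
    ultimately have "(\<lambda>n. norm (s n x - u n x)) \<longlonglongrightarrow> 0"
      by (rule Lim_transform_eventually)
    then have "(\<lambda>n. (s n x - u n x) + u n x) \<longlonglongrightarrow> 0 + f x"
      using elim(1) by (intro tendsto_add) (simp_all add: tendsto_norm_zero_iff)
    then show ?case by simp
  qed
  with s show ?thesis unfolding strongly_measurable_def by blast
qed

text \<open>Extension by 0 brings functions on intervals to the whole line, where changing the
  interval and translating become identities between functions.\<close>

lemma strongly_measurable_restrict:
  assumes A: "A \<in> sets lebesgue"
  shows "strongly_measurable (lebesgue_on A) f \<longleftrightarrow> strongly_measurable lebesgue (\<lambda>x. indicator A x *\<^sub>R f x)"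
proof
  assume "strongly_measurable (lebesgue_on A) f"
  then obtain s where s: "\<And>i::nat. simple_function (lebesgue_on A) (s i)"
    and lim: "AE x in lebesgue_on A. (\<lambda>i. s i x) \<longlonglongrightarrow> f x"
    unfolding strongly_measurable_def by blast
  from lim have "AE x in lebesgue. x \<in> A \<longrightarrow> (\<lambda>i. s i x) \<longlonglongrightarrow> f x"
    using A by (simp add: AE_restrict_space_iff)
  then have "AE x in lebesgue. (\<lambda>i. indicator A x *\<^sub>R s i x) \<longlonglongrightarrow> indicator A x *\<^sub>R f x"
    by eventually_elim (auto simp: indicator_def)
  moreover have "simple_function lebesgue (\<lambda>x. indicator A x *\<^sub>R s i x)" for i
    using s[of i] A by (subst (asm) simple_function_restrict_space) auto
  ultimately show "strongly_measurable lebesgue (\<lambda>x. indicator A x *\<^sub>R f x)"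
    unfolding strongly_measurable_def by (intro exI[of _ "\<lambda>i x. indicator A x *\<^sub>R s i x"]) auto
next
  assume "strongly_measurable lebesgue (\<lambda>x. indicator A x *\<^sub>R f x)"
  then obtain s where s: "\<And>i::nat. simple_function lebesgue (s i)"
    and lim: "AE x in lebesgue. (\<lambda>i. s i x) \<longlonglongrightarrow> indicator A x *\<^sub>R f x"
    unfolding strongly_measurable_def by blast
  from lim have "AE x in lebesgue. x \<in> A \<longrightarrow> (\<lambda>i. s i x) \<longlonglongrightarrow> f x"
    by eventually_elim auto
  then have "AE x in lebesgue_on A. (\<lambda>i. s i x) \<longlonglongrightarrow> f x"
    using A by (simp add: AE_restrict_space_iff)
  moreover have "simple_function lebesgue (\<lambda>x. indicator A x *\<^sub>R s i x)" for i
    using s[of i] A by (intro simple_function_compose2[where h="(*\<^sub>R)" and f="indicator A"]) auto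
  then have "simple_function (lebesgue_on A) (s i)" for i
    using A by (subst simple_function_restrict_space) auto
  ultimately show "strongly_measurable (lebesgue_on A) f"
    unfolding strongly_measurable_def by blast
qed

section \<open>Translation invariance of Lebesgue measure\<close>

lemma measurable_lebesgue_translation: "(\<lambda>x. c + x) \<in> measurable lebesgue (lebesgue :: real measure)"
  using lebesgue_affine_measurable[of "\<lambda>_. 1" c] by simp

lemma distr_lebesgue_translation: "distr lebesgue lebesgue (\<lambda>x. c + x) = (lebesgue :: real measure)"
  by (rule lebesgue_real_affine[of 1 c, OF one_neq_zero, unfolded mult_1 abs_one ennreal_1 density_1, symmetric])

lemma AE_lebesgue_translation:
  assumes "AE x in lebesgue. P (x::real)"
  shows "AE x in lebesgue. P (c + x)"
proof -
  have "AE x in distr lebesgue lebesgue (\<lambda>x. c + x). P x"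
    using assms by (simp only: distr_lebesgue_translation)
  then show ?thesis
    by (rule AE_distrD[OF measurable_lebesgue_translation])
qed

lemma strongly_measurable_translation:
  fixes f :: "real \<Rightarrow> 'b::real_normed_vector"
  assumes "strongly_measurable lebesgue f"
  shows "strongly_measurable lebesgue (\<lambda>x. f (c + x))"
proof -
  from assms obtain s where s: "\<And>i::nat. simple_function lebesgue (s i)"
    and lim: "AE x in lebesgue. (\<lambda>i. s i x) \<longlonglongrightarrow> f x"
    unfolding strongly_measurable_def by blast
  have "simple_function lebesgue (\<lambda>x. s i (c + x))" for i
  proof -
    have "finite (range (\<lambda>x. s i (c + x)))"
      using s[of i] by (auto simp: simple_function_def intro: finite_subset[of _ "range (s i)"])
    moreover have "(\<lambda>x. s i (c + x)) -` {y} \<in> sets lebesgue" for y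
    proof -
      have "s i -` {y} \<inter> space lebesgue \<in> sets lebesgue"
        using s[of i] by (rule simple_functionD(2))
      from measurable_sets[OF measurable_lebesgue_translation this, of c]
      show ?thesis by (simp add: vimage_def)
    qed
    ultimately show ?thesis by (auto simp: simple_function_def)
  qed
  with AE_lebesgue_translation[OF lim, of c] show ?thesis
    unfolding strongly_measurable_def by (intro exI[of _ "\<lambda>i x. s i (c + x)"]) auto
qed

text \<open>A functional carries simple approximants to simple approximants and multiplies the
  errors by at most its bound \<open>K\<close>. Vector integrals thus become ordinary integrals of
  complex functions.\<close>

lemma has_strong_integral_bounded_linear:
  fixes \<phi> :: "'b::real_normed_vector \<Rightarrow> complex"
  assumes M: "complete_measure M" and f: "has_strong_integral M f I" and \<phi>: "bounded_linear \<phi>"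
  shows "has_bochner_integral M (\<lambda>x. \<phi> (f x)) (\<phi> I)"
proof -
  interpret complete_measure M by fact
  interpret \<phi>: bounded_linear \<phi> by fact
  from f have sm: "strongly_measurable M f" unfolding has_strong_integral_def by (rule conjunct1)
  from f obtain s where s': "\<forall>i::nat. Bochner_Integration.simple_bochner_integrable M (s i)"
    and lim: "(\<lambda>i. \<integral>\<^sup>+x. ennreal (norm (f x - s i x)) \<partial>M) \<longlonglongrightarrow> 0"
    and lim_I: "(\<lambda>i. Bochner_Integration.simple_bochner_integral M (s i)) \<longlonglongrightarrow> I"
    unfolding has_strong_integral_def by (elim conjE exE) (rule that)
  from s' have s: "\<And>i. Bochner_Integration.simple_bochner_integrable M (s i)" by simp
  obtain K where K: "K > 0" "\<And>x. norm (\<phi> x) \<le> norm x * K"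
    using \<phi>.pos_bounded by blast
  have sf: "simple_function M (s i)" for i
    using s[of i] by (auto simp: Bochner_Integration.simple_bochner_integrable.simps)
  show ?thesis
  proof (rule has_bochner_integral.intros)
    show "(\<lambda>x. \<phi> (f x)) \<in> borel_measurable M"
      by (rule strongly_measurable_imp_borel[OF strongly_measurable_bounded_linear[OF \<phi> sm]])
    show "Bochner_Integration.simple_bochner_integrable M (\<lambda>x. \<phi> (s i x))" for i
      using s[of i] by (intro Bochner_Integration.simple_bochner_integrable_compose2[where p="\<lambda>x _. \<phi> x"])
        (auto simp: \<phi>.zero)
    show "(\<lambda>i. Bochner_Integration.simple_bochner_integral M (\<lambda>x. \<phi> (s i x))) \<longlonglongrightarrow> \<phi> I"
      using \<phi>.tendsto[OF lim_I] s
      by (simp add: Bochner_Integration.simple_bochner_integral_linear \<phi>.linear_axioms)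
    have [measurable]: "(\<lambda>x. norm (f x - s i x)) \<in> borel_measurable M" for i
    proof (rule strongly_measurable_imp_borel_norm)
      have "strongly_measurable M (s i)"
        unfolding strongly_measurable_def using sf by (intro exI[of _ "\<lambda>_. s i"]) auto
      then show "strongly_measurable M (\<lambda>x. f x - s i x)"
        by (rule strongly_measurable_diff[OF sm])
    qed
    show "(\<lambda>i. \<integral>\<^sup>+x. ennreal (norm (\<phi> (f x) - \<phi> (s i x))) \<partial>M) \<longlonglongrightarrow> 0"
    proof (rule tendsto_sandwich[where f="\<lambda>_. 0"])
      show "(\<lambda>i. ennreal K * (\<integral>\<^sup>+x. ennreal (norm (f x - s i x)) \<partial>M)) \<longlonglongrightarrow> 0"
        using ennreal_tendsto_cmult[OF _ lim, of "ennreal K"] by simp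
      show "\<forall>\<^sub>F i in sequentially. (\<integral>\<^sup>+x. ennreal (norm (\<phi> (f x) - \<phi> (s i x))) \<partial>M)
          \<le> ennreal K * (\<integral>\<^sup>+x. ennreal (norm (f x - s i x)) \<partial>M)"
      proof (intro always_eventually allI)
        fix i
        have "(\<integral>\<^sup>+x. ennreal (norm (\<phi> (f x) - \<phi> (s i x))) \<partial>M)
            \<le> (\<integral>\<^sup>+x. ennreal K * ennreal (norm (f x - s i x)) \<partial>M)"
          using K by (intro nn_integral_mono)
            (simp add: \<phi>.diff[symmetric] ennreal_mult[symmetric] mult.commute)
        also have "\<dots> = ennreal K * (\<integral>\<^sup>+x. ennreal (norm (f x - s i x)) \<partial>M)"
          by (rule nn_integral_cmult) measurable
        finally show "(\<integral>\<^sup>+x. ennreal (norm (\<phi> (f x) - \<phi> (s i x))) \<partial>M)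
            \<le> ennreal K * (\<integral>\<^sup>+x. ennreal (norm (f x - s i x)) \<partial>M)" .
      qed
    qed auto
  qed
qed

section \<open>A Baire category argument\<close>

text \<open>Otherwise the closures would be countably many closed sets without interior points that
  cover the space, against Baire's theorem.\<close>

lemma Baire_closure_interior:
  fixes D :: "nat \<Rightarrow> 'a::banach set"
  assumes "\<And>x. \<exists>n. x \<in> D n"
  shows "\<exists>n. interior (closure (D n)) \<noteq> {}"
proof (rule ccontr)
  assume "\<not> ?thesis"
  then have int: "interior (closure (D n)) = {}" for n by blast
  have "Met_TC.mcomplete TYPE('a)"
    unfolding Met_TC.mcomplete_def
    by (auto simp: Cauchy_convergent_iff convergent_def)
  then have "(Met_TC.mtopology :: 'a topology) interior_of \<Union>(range (\<lambda>n. closure (D n))) = {}"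
    by (rule Met_TC.metric_Baire_category_alt) (use int in auto)
  moreover have "\<Union>(range (\<lambda>n. closure (D n))) = UNIV"
    using assms closure_subset by blast
  ultimately show False by simp
qed

text \<open>Closedness under \<open>\<Sum>k. x k / 2^k\<close> replaces closedness in the usual absorption
  argument, so that the lemma applies to images of bounded sets under linear relations.\<close>

lemma absorbing_series_closed_contains_cball:
  fixes D :: "'a::banach set"
  assumes absorb: "\<And>x. \<exists>n::nat. x /\<^sub>R (1 + real n) \<in> D"
    and mid: "\<And>x y. x \<in> D \<Longrightarrow> y \<in> D \<Longrightarrow> (x - y) /\<^sub>R 2 \<in> D"
    and series: "\<And>x y. (\<And>k::nat. x k \<in> D) \<Longrightarrow> (\<lambda>k. (1/2)^k *\<^sub>R x k) sums y \<Longrightarrow> y /\<^sub>R 2 \<in> D"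
  shows "\<exists>r>0. \<forall>x. norm x \<le> r \<longrightarrow> x \<in> D"
proof -
  obtain n :: nat where n: "interior (closure ((\<lambda>x. (1 + real n) *\<^sub>R x) ` D)) \<noteq> {}"
  proof -
    have "\<exists>n::nat. x \<in> (\<lambda>x. (1 + real n) *\<^sub>R x) ` D" for x
    proof -
      from absorb[of x] obtain n :: nat where "x /\<^sub>R (1 + real n) \<in> D" by blast
      then show ?thesis by (intro exI[of _ n] image_eqI[of _ _ "x /\<^sub>R (1 + real n)"]) auto
    qed
    from Baire_closure_interior[of "\<lambda>n. (\<lambda>x. (1 + real n) *\<^sub>R x) ` D", OF this] that
    show thesis by blast
  qed
  then obtain x0 where "x0 \<in> interior (closure ((\<lambda>x. (1 + real n) *\<^sub>R x) ` D))" by blast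
  then obtain e where e: "e > 0" "ball x0 e \<subseteq> closure ((\<lambda>x. (1 + real n) *\<^sub>R x) ` D)"
    by (auto simp: mem_interior)
  \<comment> \<open>For \<open>norm x < s\<close> the point x0 + 2 (1 + n) x stays in the ball; the
    factor 2 is undone by the halving in \<open>mid\<close>.\<close>
  define s where "s = e / (2 * (1 + real n))"
  have s: "s > 0" using e by (simp add: s_def)
  have dense: "\<exists>d\<in>D. norm (x - d) < \<delta>" if x: "norm x < s" and \<delta>: "\<delta> > 0" for x \<delta>
  proof -
    define c where "c = 1 + real n"
    have c: "c \<ge> 1" by (simp add: c_def)
    have cl: "\<exists>d\<in>D. norm (z - c *\<^sub>R d) < \<delta>" if "z \<in> ball x0 e" for z
    proof -
      have "z \<in> closure ((\<lambda>x. c *\<^sub>R x) ` D)" using that e by (auto simp: c_def)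
      with \<delta> show ?thesis by (auto simp: closure_approachable dist_norm norm_minus_commute)
    qed
    have "norm ((2 * c) *\<^sub>R x) < e"
    proof -
      have "norm ((2 * c) *\<^sub>R x) = 2 * c * norm x" using c by simp
      also have "\<dots> < 2 * c * s" using x c by simp
      also have "\<dots> = e" using c by (simp add: s_def c_def)
      finally show ?thesis .
    qed
    then obtain d where d: "d \<in> D" "norm (x0 + (2 * c) *\<^sub>R x - c *\<^sub>R d) < \<delta>"
      using cl[of "x0 + (2 * c) *\<^sub>R x"] by (auto simp: dist_norm)
    obtain d' where d': "d' \<in> D" "norm (x0 - c *\<^sub>R d') < \<delta>"
      using cl[of x0] e by auto
    \<comment> \<open>The unknown centre \<open>x0\<close> cancels in the difference of the two
      approximations.\<close>
    have "(2 * c) *\<^sub>R (x - (d - d') /\<^sub>R 2) = (x0 + (2 * c) *\<^sub>R x - c *\<^sub>R d) - (x0 - c *\<^sub>R d')"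
      by (simp add: algebra_simps)
    then have "2 * c * norm (x - (d - d') /\<^sub>R 2) = norm ((x0 + (2 * c) *\<^sub>R x - c *\<^sub>R d) - (x0 - c *\<^sub>R d'))"
      using c by (metis abs_of_nonneg mult_nonneg_nonneg norm_scaleR order_trans zero_le_numeral zero_le_one)
    also have "\<dots> < 2 * \<delta>"
      using norm_triangle_ineq4[of "x0 + (2 * c) *\<^sub>R x - c *\<^sub>R d" "x0 - c *\<^sub>R d'"] d d' by linarith
    finally have "c * norm (x - (d - d') /\<^sub>R 2) < \<delta>" by simp
    moreover have "1 * norm (x - (d - d') /\<^sub>R 2) \<le> c * norm (x - (d - d') /\<^sub>R 2)"
      using c by (intro mult_right_mono) auto
    ultimately have "norm (x - (d - d') /\<^sub>R 2) < \<delta>" by linarith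
    with mid[OF d(1) d'(1)] show ?thesis by blast
  qed
  define pick where "pick x = (SOME d. d \<in> D \<and> norm (x - d) < s / 2)" for x
  have pick: "pick x \<in> D \<and> norm (x - pick x) < s / 2" if "norm x < s" for x
    unfolding pick_def by (rule someI_ex) (use dense[OF that, of "s/2"] s in auto)
  have half: "x /\<^sub>R 2 \<in> D" if x: "norm x < s" for x
  proof -
    \<comment> \<open>Each remainder is approximated within s/2 and doubled, which brings it back
      below s; the doublings produce the weights 2^-k in the expansion of \<open>x\<close>.\<close>
    define z where "z = rec_nat x (\<lambda>_ z. 2 *\<^sub>R (z - pick z))"
    have z0: "z 0 = x" and zS: "z (Suc k) = 2 *\<^sub>R (z k - pick (z k))" for k
      by (simp_all add: z_def)
    have zs: "norm (z k) < s" for k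
    proof (induction k)
      case (Suc k)
      then show ?case using pick[of "z k"] by (simp add: zS)
    qed (use x z0 in simp)
    have partial: "(\<Sum>k<m. (1/2)^k *\<^sub>R pick (z k)) = x - (1/2)^m *\<^sub>R z m" for m
      by (induction m) (simp_all add: z0 zS algebra_simps)
    have "(\<lambda>m. (1/2)^m *\<^sub>R z m) \<longlonglongrightarrow> 0"
    proof (rule Lim_null_comparison)
      show "\<forall>\<^sub>F m in sequentially. norm ((1/2)^m *\<^sub>R z m) \<le> (1/2)^m * s"
        using less_imp_le[OF zs] by (auto intro!: always_eventually divide_right_mono simp: power_one_over)
      show "(\<lambda>m. (1/2)^m * s) \<longlonglongrightarrow> 0"
        by (intro tendsto_mult_left_zero LIMSEQ_power_zero) simp
    qed
    then have "(\<lambda>m. x - (1/2)^m *\<^sub>R z m) \<longlonglongrightarrow> x - 0" by (intro tendsto_diff tendsto_const)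
    then have "(\<lambda>k. (1/2)^k *\<^sub>R pick (z k)) sums x" unfolding sums_def partial by simp
    with pick[OF zs] show ?thesis by (intro series) auto
  qed
  show ?thesis
  proof (intro exI[of _ "s/4"] conjI allI impI)
    fix x :: 'a assume "norm x \<le> s / 4"
    then show "x \<in> D" using half[of "2 *\<^sub>R x"] s by simp
  qed (use s in simp)
qed

text \<open>The previous lemma is applied to the set where every \<open>F n\<close> is at most 1 in
  norm. Its series condition holds because the weights 2^-k sum to 2, which the halving of
  \<open>y\<close> absorbs.\<close>

lemma uniform_boundedness_sequence:
  fixes F :: "nat \<Rightarrow> 'a::banach \<Rightarrow> 'b::real_normed_vector"
  assumes lin: "\<And>n. bounded_linear (F n)" and bdd: "\<And>x. \<exists>M. \<forall>n. norm (F n x) \<le> M"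
  shows "\<exists>M. \<forall>n x. norm (F n x) \<le> M * norm x"
proof -
  define D where "D = {x. \<forall>n. norm (F n x) \<le> 1}"
  have "\<exists>r>0. \<forall>x. norm x \<le> r \<longrightarrow> x \<in> D"
  proof (rule absorbing_series_closed_contains_cball)
    fix x
    from bdd[of x] obtain M where M: "\<And>n. norm (F n x) \<le> M" by blast
    obtain m :: nat where m: "M \<le> real m" using real_arch_simple by blast
    have "norm (F n x) / (1 + real m) \<le> 1" for n
      using M[of n] m by (simp add: divide_simps)
    then show "\<exists>n::nat. x /\<^sub>R (1 + real n) \<in> D"
      by (intro exI[of _ m])
        (auto simp: D_def linear_simps(5)[OF lin] divide_inverse mult.commute)
  next
    fix x y assume xy: "x \<in> D" "y \<in> D"
    have "norm (F n ((x - y) /\<^sub>R 2)) \<le> 1" for n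
    proof -
      have "norm (F n ((x - y) /\<^sub>R 2)) = norm (F n x - F n y) / 2"
        by (simp add: linear_simps(5)[OF lin] linear_simps(2)[OF lin])
      also have "\<dots> \<le> 1"
        using norm_triangle_ineq4[of "F n x" "F n y"] xy[unfolded D_def mem_Collect_eq, rule_format, of n]
        by linarith
      finally show ?thesis .
    qed
    then show "(x - y) /\<^sub>R 2 \<in> D" by (simp add: D_def)
  next
    fix x :: "nat \<Rightarrow> 'a" and y
    assume x: "\<And>k. x k \<in> D" and y: "(\<lambda>k. (1/2)^k *\<^sub>R x k) sums y"
    have "norm (F n y) \<le> 2" for n
    proof (rule Lim_norm_ubound)
      show "(\<lambda>m. F n (\<Sum>k<m. (1/2)^k *\<^sub>R x k)) \<longlonglongrightarrow> F n y"
        using y unfolding sums_def by (rule bounded_linear.tendsto[OF lin])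
      show "\<forall>\<^sub>F m in sequentially. norm (F n (\<Sum>k<m. (1/2)^k *\<^sub>R x k)) \<le> 2"
      proof (intro always_eventually allI)
        fix m
        interpret Fn: bounded_linear "F n" by (rule lin)
        have "norm (F n (\<Sum>k<m. (1/2)^k *\<^sub>R x k)) \<le> (\<Sum>k<m. (1/2)^k * norm (F n (x k)))"
          unfolding Fn.sum Fn.scaleR by (rule order_trans[OF norm_sum]) (simp add: power_one_over)
        also have "\<dots> \<le> (\<Sum>k<m. (1/2)^k * 1)"
          using x by (intro sum_mono mult_left_mono) (auto simp: D_def)
        also have "\<dots> \<le> (\<Sum>k. (1/2)^k)"
          by (simp only: mult_1_right) (intro sum_le_suminf summable_geometric; simp)
        also have "\<dots> = (2::real)" by (subst suminf_geometric) auto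
        finally show "norm (F n (\<Sum>k<m. (1/2)^k *\<^sub>R x k)) \<le> 2" .
      qed
    qed simp
    then show "y /\<^sub>R 2 \<in> D"
      by (simp add: D_def linear_simps(5)[OF lin])
  qed
  then obtain r where r: "r > 0" "\<And>x. norm x \<le> r \<Longrightarrow> x \<in> D" by blast
  have "norm (F n x) \<le> (1 / r) * norm x" for n x
  proof (cases "x = 0")
    case False
    have "(r / norm x) *\<^sub>R x \<in> D" using r(1) False by (intro r(2)) simp
    then have "norm (F n ((r / norm x) *\<^sub>R x)) \<le> 1" by (simp add: D_def)
    then have "(r / norm x) * norm (F n x) \<le> 1"
      using r(1) by (simp add: linear_simps(5)[OF lin])
    then show ?thesis using r(1) False by (simp add: field_simps)
  qed (simp add: linear_simps(3)[OF lin])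
  then show ?thesis by blast
qed

section \<open>Semigroups\<close>

lemma scaleC_zero_right [simp]: "c *\<^sub>C (0::'a::complex_banach) = 0"
  using scaleC_add_right[of c 0 "0::'a"] by simp

lemma scaleC_one [simp]: "1 *\<^sub>C x = (x::'a::complex_banach)"
  using scaleR_scaleC[of 1 x] by simp

lemma scaleC_zero_left [simp]: "0 *\<^sub>C x = (0::'a::complex_banach)"
  using scaleR_scaleC[of 0 x] by simp

lemma scaleC_minus_one: "(-1) *\<^sub>C x = - (x::'a::complex_banach)"
  using scaleR_scaleC[of "-1" x] by simp

lemma scaleC_minus_right: "c *\<^sub>C (- x) = - (c *\<^sub>C (x::'a::complex_banach))"
  using scaleC_add_right[of c x "- x"] by (simp add: eq_neg_iff_add_eq_0 add.commute)

lemma scaleC_diff_right: "c *\<^sub>C (x - y) = c *\<^sub>C x - c *\<^sub>C (y::'a::complex_banach)"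
  using scaleC_add_right[of c x "- y"] by (simp add: scaleC_minus_right)

lemma scaleC_diff_left: "(c - d) *\<^sub>C x = c *\<^sub>C x - d *\<^sub>C (x::'a::complex_banach)"
  using scaleC_add_left[of "c - d" d x] by (simp add: algebra_simps)

lemma bounded_linear_scaleC_right: "bounded_linear ((*\<^sub>C) c :: 'a::complex_banach \<Rightarrow> 'a)"
  by (rule bounded_linear_intro[where K="cmod c"])
    (simp_all add: scaleC_add_right norm_scaleC mult.commute scaleR_scaleC scaleC_scaleC)

lemma bounded_linear_scaleC_left: "bounded_linear (\<lambda>c. c *\<^sub>C (x::'a::complex_banach))"
proof (rule bounded_linear_intro[where K="norm x"])
  show "(r *\<^sub>R c) *\<^sub>C x = r *\<^sub>R c *\<^sub>C x" for r c
    by (simp only: scaleR_conv_of_real scaleR_scaleC[of r "c *\<^sub>C x"] scaleC_scaleC)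
qed (simp_all add: scaleC_add_left norm_scaleC)

lemma csubspace_diff: "csubspace V \<Longrightarrow> x \<in> V \<Longrightarrow> y \<in> V \<Longrightarrow> x - y \<in> V"
  unfolding csubspace_def using scaleC_minus_one[of y] by (metis diff_conv_add_uminus)

locale semigroup_C0 =
  fixes S :: "real \<Rightarrow> 'h::complex_banach \<Rightarrow> 'h"
  assumes c0: "c0_semigroup S"
begin

lemma bounded_linear: "t \<ge> 0 \<Longrightarrow> bounded_linear (S t)"
  using c0 by (auto simp: c0_semigroup_def bounded_clinear_def)

lemma scaleC: "t \<ge> 0 \<Longrightarrow> S t (c *\<^sub>C x) = c *\<^sub>C S t x"
  using c0 by (auto simp: c0_semigroup_def bounded_clinear_def)

lemma add: "t \<ge> 0 \<Longrightarrow> S t (x + y) = S t x + S t y"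
  using linear_simps(1)[OF bounded_linear] .

lemma diff: "t \<ge> 0 \<Longrightarrow> S t (x - y) = S t x - S t y"
  using linear_simps(2)[OF bounded_linear] .

lemma zero: "t \<ge> 0 \<Longrightarrow> S t 0 = 0"
  using linear_simps(3)[OF bounded_linear] .

lemma S0: "S 0 x = x"
  using c0 by (simp add: c0_semigroup_def)

lemma semigroup: "s \<ge> 0 \<Longrightarrow> t \<ge> 0 \<Longrightarrow> S (s + t) x = S s (S t x)"
  using c0 by (simp add: c0_semigroup_def)

lemma tendsto_at_right_0: "((\<lambda>t. S t x) \<longlongrightarrow> x) (at_right 0)"
  using c0 by (simp add: c0_semigroup_def)

text \<open>Factoring \<open>S t\<close> out of \<open>S (t + h n)\<close> reduces this to
  continuity at 0. One-sided limits suffice for the measurability of orbits.\<close>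

lemma tendsto_right:
  assumes t: "t \<ge> 0" and h: "\<And>n. h n > 0" "h \<longlonglongrightarrow> 0"
  shows "(\<lambda>n. S (t + h n) x) \<longlonglongrightarrow> S t x"
proof -
  have "filterlim h (at_right 0) sequentially"
    using h by (auto simp: filterlim_at less_imp_neq[THEN not_sym])
  then have "(\<lambda>n. S (h n) x) \<longlonglongrightarrow> x"
    by (rule filterlim_compose[OF tendsto_at_right_0])
  then have "(\<lambda>n. S t (S (h n) x)) \<longlonglongrightarrow> S t x"
    by (rule bounded_linear.tendsto[OF bounded_linear[OF t]])
  then show ?thesis using t h by (simp add: semigroup less_imp_le)
qed

text \<open>Failure would give times tending to 0 whose operators exceed every bound although they
  converge at each vector, against uniform boundedness.\<close>

lemma locally_bounded: "\<exists>\<delta>>0. \<exists>M. \<forall>t\<in>{0..\<delta>}. \<forall>x. norm (S t x) \<le> M * norm x"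
proof (rule ccontr)
  assume "\<not> ?thesis"
  then have *: "\<And>\<delta> M. \<delta> > 0 \<Longrightarrow> \<exists>t\<in>{0..\<delta>}. \<exists>x. \<not> norm (S t x) \<le> M * norm x" by blast
  have "\<exists>t\<in>{0..1 / (1 + real n)}. \<exists>x. \<not> norm (S t x) \<le> real n * norm x" for n
    by (rule *) simp
  then obtain t where t: "\<And>n. t n \<in> {0..1 / (1 + real n)}"
    and big: "\<And>n. \<exists>x. \<not> norm (S (t n) x) \<le> real n * norm x" by metis
  have t0: "t n \<ge> 0" for n using t[of n] by simp
  have "(\<lambda>n. 1 / (1 + real n)) \<longlonglongrightarrow> 0"
    using LIMSEQ_inverse_real_of_nat by (simp add: divide_inverse add.commute)
  then have t_lim: "t \<longlonglongrightarrow> 0"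
    using t by (intro tendsto_sandwich[of "\<lambda>_. 0" t _ "\<lambda>n. 1 / (1 + real n)"]) auto
  have "\<exists>M. \<forall>n. norm (S (t n) x) \<le> M" for x
  proof -
    \<comment> \<open>The times \<open>t n\<close> may be 0, so the limit from the right is read as
      continuity within the closed half line.\<close>
    have "((\<lambda>t. S t x) \<longlongrightarrow> x) (at 0 within {0..})"
    proof -
      have "at (0::real) within {0..} = at_right 0"
        by (rule at_within_nhd[of _ UNIV]) auto
      then show ?thesis using tendsto_at_right_0 by simp
    qed
    then have "continuous (at 0 within {0..}) (\<lambda>t. S t x)"
      by (simp add: continuous_within S0)
    then have "(\<lambda>n. S (t n) x) \<longlonglongrightarrow> S 0 x"
      using t0 t_lim by (auto intro: continuous_within_tendsto_compose')
    then have "Bseq (\<lambda>n. S (t n) x)" by (rule convergentI[THEN convergent_imp_Bseq])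
    then show ?thesis by (auto simp: Bseq_def)
  qed
  with t0 have "\<exists>M. \<forall>n x. norm (S (t n) x) \<le> M * norm x"
    by (intro uniform_boundedness_sequence bounded_linear) auto
  then obtain M where M: "\<And>n x. norm (S (t n) x) \<le> M * norm x" by blast
  obtain n :: nat where n: "M \<le> real n" using real_arch_simple by blast
  have "norm (S (t n) x) \<le> real n * norm x" for x
    using M[of n x] mult_right_mono[OF n, of "norm x"] by simp
  with big[of n] show False by blast
qed

text \<open>Long times are split into steps of length at most \<delta>. With \<open>M\<close> \<ge>
  1 a higher power is a weaker bound, so one power covers all shorter times.\<close>

lemma bounded_on_interval: "\<exists>M\<ge>1. \<forall>t\<in>{0..T}. \<forall>x. norm (S t x) \<le> M * norm x"
proof -
  from locally_bounded obtain \<delta> M0 where \<delta>: "\<delta> > 0"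
    and M0: "\<And>t x. t \<in> {0..\<delta>} \<Longrightarrow> norm (S t x) \<le> M0 * norm x" by blast
  define M where "M = max 1 M0"
  have M: "M \<ge> 1" by (simp add: M_def)
  have M': "norm (S t x) \<le> M * norm x" if "t \<in> {0..\<delta>}" for t x
    using M0[OF that, of x] mult_right_mono[of M0 M "norm x"] by (simp add: M_def)
  have step: "norm (S t x) \<le> M ^ Suc n * norm x" if "t \<in> {0..(1 + real n) * \<delta>}" for n t x
    using that
  proof (induction n arbitrary: t)
    case 0
    then show ?case using M'[of t x] by simp
  next
    case (Suc n)
    show ?case
    proof (cases "t \<le> \<delta>")
      case True
      then have "norm (S t x) \<le> M * norm x" using Suc.prems by (intro M') auto
      also have "\<dots> \<le> M ^ Suc (Suc n) * norm x"
        using M by (intro mult_right_mono) (auto simp: mult_le_cancel_left1 one_le_power simp del: power_Suc simp: power_Suc[of M "Suc n"])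
      finally show ?thesis .
    next
      case False
      have "S t x = S (\<delta> + (t - \<delta>)) x" by simp
      also have "\<dots> = S \<delta> (S (t - \<delta>) x)" using False \<delta> by (intro semigroup) auto
      finally have "norm (S t x) \<le> M * norm (S (t - \<delta>) x)"
        using M'[of \<delta> "S (t - \<delta>) x"] \<delta> by simp
      also have "\<dots> \<le> M * (M ^ Suc n * norm x)"
        using Suc.prems False M by (intro mult_left_mono Suc.IH) (auto simp: algebra_simps)
      finally show ?thesis by simp
    qed
  qed
  obtain n :: nat where "T / \<delta> \<le> real n" using real_arch_simple by blast
  then have "T \<le> (1 + real n) * \<delta>" using \<delta> by (simp add: field_simps)
  then show ?thesis using step[of _ n] M one_le_power[OF M, of "Suc n"]
    by (intro exI[of _ "M ^ Suc n"]) auto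
qed

lemma generator_invariant:
  assumes t: "t \<ge> 0" and xy: "(x, y) \<in> generator S"
  shows "(S t x, S t y) \<in> generator S"
proof -
  have "((\<lambda>h. S t ((S h x - x) /\<^sub>R h)) \<longlongrightarrow> S t y) (at_right 0)"
    using xy by (intro bounded_linear.tendsto[OF bounded_linear[OF t]]) (simp add: generator_def)
  moreover have "\<forall>\<^sub>F h in at_right 0. S t ((S h x - x) /\<^sub>R h) = (S h (S t x) - S t x) /\<^sub>R h"
    using eventually_at_right_less[of 0]
  proof eventually_elim
    case (elim h)
    then have "S t (S h x) = S h (S t x)"
      using t semigroup[of t h x] semigroup[of h t x] by (simp add: add.commute)
    then show ?case using t
      by (simp add: diff scaleC scaleR_scaleC)
  qed
  ultimately show ?thesis
    unfolding generator_def by (auto elim: Lim_transform_eventually)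
qed

text \<open>Over \<open>n\<close> steps of length \<open>h = t / n\<close> the error \<open>S h x - exp(\<mu> h) x + h w = o(h)\<close>
  accumulates to \<open>o(1)\<close>; the remaining terms lie in \<open>N\<close>.\<close>

lemma semigroup_modulo_subspace:
  assumes N: "csubspace N" "closed N" and \<mu>: "Re \<mu> \<le> 0"
    and xy: "(x, y) \<in> generator S" and w0: "\<And>s. s \<ge> 0 \<Longrightarrow> S s (\<mu> *\<^sub>C x - y) \<in> N"
    and t: "t > 0"
  shows "S t x - exp (\<mu> * of_real t) *\<^sub>C x \<in> N"
proof -
  define w where "w = \<mu> *\<^sub>C x - y"
  have wN: "S s w \<in> N" if "s \<ge> 0" for s using w0[OF that] by (simp add: w_def)
  define E where "E s = exp (\<mu> * of_real s)" for s :: real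
  have E_add: "E (s + r) = E s * E r" for s r by (simp add: E_def exp_add algebra_simps)
  \<comment> \<open>This keeps the errors of earlier steps from being amplified.\<close>
  have E_le: "cmod (E s) \<le> 1" if "s \<ge> 0" for s
    using that \<mu> by (simp add: E_def mult_nonpos_nonneg)
  define \<rho> where "\<rho> h = S h x - E h *\<^sub>C x + h *\<^sub>R w" for h
  have \<rho>_lim: "((\<lambda>h. norm (\<rho> h /\<^sub>R h)) \<longlongrightarrow> 0) (at_right 0)"
  proof -
    have "((\<lambda>z. exp (\<mu> * z)) has_field_derivative \<mu>) (at 0)"
      by (auto intro!: derivative_eq_intros)
    then have "((\<lambda>z. (exp (\<mu> * z) - 1) / z) \<longlongrightarrow> \<mu>) (at 0)"
      by (simp add: DERIV_def)
    moreover have "filterlim complex_of_real (at 0) (at_right 0)"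
    proof -
      have "(complex_of_real \<longlongrightarrow> of_real 0) (at_right 0)"
        by (intro tendsto_intros)
      then show ?thesis
        using eventually_at_right_less[of "0::real"] by (auto simp: filterlim_at elim: eventually_mono)
    qed
    ultimately have "((\<lambda>h. (exp (\<mu> * complex_of_real h) - 1) / complex_of_real h) \<longlongrightarrow> \<mu>) (at_right 0)"
      by (rule filterlim_compose)
    then have "((\<lambda>h. (E h - 1) /\<^sub>R h) \<longlongrightarrow> \<mu>) (at_right 0)"
      by (simp add: E_def scaleR_conv_of_real divide_inverse mult.commute)
    then have "((\<lambda>h. ((E h - 1) /\<^sub>R h) *\<^sub>C x) \<longlongrightarrow> \<mu> *\<^sub>C x) (at_right 0)"
      by (rule bounded_linear.tendsto[OF bounded_linear_scaleC_left])
    moreover have "((\<lambda>h. (S h x - x) /\<^sub>R h) \<longlongrightarrow> y) (at_right 0)"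
      using xy by (simp add: generator_def)
    ultimately have "((\<lambda>h. (S h x - x) /\<^sub>R h - ((E h - 1) /\<^sub>R h) *\<^sub>C x + w) \<longlongrightarrow> y - \<mu> *\<^sub>C x + w) (at_right 0)"
      by (intro tendsto_intros)
    moreover have "y - \<mu> *\<^sub>C x + w = 0" by (simp add: w_def)
    moreover have "\<forall>\<^sub>F h in at_right 0.
        (S h x - x) /\<^sub>R h - ((E h - 1) /\<^sub>R h) *\<^sub>C x + w = \<rho> h /\<^sub>R h"
      using eventually_at_right_less[of 0]
    proof eventually_elim
      case (elim h)
      have "((E h - 1) /\<^sub>R h) *\<^sub>C x = (E h *\<^sub>C x - x) /\<^sub>R h"
        by (simp add: linear_simps(5)[OF bounded_linear_scaleC_left] scaleC_diff_left)
      then show ?case using elim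
        by (simp add: \<rho>_def algebra_simps)
    qed
    ultimately show ?thesis
      by (intro tendsto_norm_zero) (auto elim: Lim_transform_eventually)
  qed
  obtain M where M: "M \<ge> 1" "\<And>s z. s \<in> {0..t} \<Longrightarrow> norm (S s z) \<le> M * norm z"
    using bounded_on_interval[of t] by blast
  have step: "\<exists>m\<in>N. norm (S (real k * h) x - E (real k * h) *\<^sub>C x - m) \<le> real k * (M * norm (\<rho> h))"
    if h: "h > 0" and k: "real k * h \<le> t" for h and k :: nat
    using k
  proof (induction k)
    case 0
    then show ?case using N by (auto simp: S0 E_def csubspace_def intro!: bexI[of _ 0])
  next
    case (Suc k)
    define s where "s = real k * h"
    have s: "s \<ge> 0" "s + h \<le> t" "real (Suc k) * h = s + h"
      using h Suc.prems by (simp_all add: s_def algebra_simps)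
    with Suc.IH h obtain m where m: "m \<in> N"
      "norm (S s x - E s *\<^sub>C x - m) \<le> real k * (M * norm (\<rho> h))" by (auto simp: s_def)
    \<comment> \<open>The old correction is propagated by one step and the \<open>w\<close> term of
      \<open>\<rho> h\<close> is added; what remains is \<open>S s (\<rho> h)\<close> and the old
      error times \<open>E h\<close>.\<close>
    define m' where "m' = E h *\<^sub>C m - h *\<^sub>R S s w"
    have "m' \<in> N" unfolding m'_def
      using N wN[OF s(1)] m by (intro csubspace_diff) (auto simp: csubspace_def scaleR_scaleC)
    moreover have "S (s + h) x - E (s + h) *\<^sub>C x - m'
        = S s (\<rho> h) + E h *\<^sub>C (S s x - E s *\<^sub>C x - m)"
    proof -
      have "S s (\<rho> h) = S (s + h) x - E h *\<^sub>C S s x + h *\<^sub>R S s w"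
        using s h by (simp add: \<rho>_def add diff scaleC scaleR_scaleC semigroup)
      then show ?thesis
        by (simp add: m'_def scaleC_diff_right scaleC_scaleC E_add mult.commute)
    qed
    then have "norm (S (s + h) x - E (s + h) *\<^sub>C x - m')
        \<le> norm (S s (\<rho> h)) + cmod (E h) * norm (S s x - E s *\<^sub>C x - m)"
      by (metis norm_scaleC norm_triangle_ineq)
    moreover have "norm (S s (\<rho> h)) \<le> M * norm (\<rho> h)" using s h by (intro M) auto
    moreover have "cmod (E h) * norm (S s x - E s *\<^sub>C x - m) \<le> 1 * (real k * (M * norm (\<rho> h)))"
      using E_le[of h] h m by (intro mult_mono) auto
    ultimately show ?case
      unfolding s(3) by (intro bexI[of _ m']) (auto simp: algebra_simps)
  qed
  have "\<exists>m\<in>N. dist m (S t x - E t *\<^sub>C x) < \<epsilon>" if \<epsilon>: "\<epsilon> > 0" for \<epsilon>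
  proof -
    have "filterlim (\<lambda>n. t / real (Suc n)) (at_right 0) sequentially"
      using t LIMSEQ_inverse_real_of_nat[THEN tendsto_mult_right, of t]
      by (auto simp: filterlim_at divide_inverse)
    then have "(\<lambda>n. norm (\<rho> (t / real (Suc n)) /\<^sub>R (t / real (Suc n)))) \<longlonglongrightarrow> 0"
      by (rule filterlim_compose[OF \<rho>_lim])
    \<comment> \<open>There are t/h steps, each contributing at most
      \<open>M * norm (\<rho> h)\<close>; this threshold keeps the total below \<epsilon>.\<close>
    then have "\<forall>\<^sub>F n in sequentially. norm (\<rho> (t / real (Suc n)) /\<^sub>R (t / real (Suc n))) < \<epsilon> / (t * M)"
      by (rule order_tendstoD(2)) (use \<epsilon> t M in simp)
    then obtain n where n: "norm (\<rho> (t / real (Suc n)) /\<^sub>R (t / real (Suc n))) < \<epsilon> / (t * M)"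
      by (auto simp: eventually_sequentially)
    define h where "h = t / real (Suc n)"
    have h: "h > 0" "real (Suc n) * h = t" using t by (simp_all add: h_def)
    have "norm (\<rho> h) / h < \<epsilon> / (t * M)"
      using n h(1) unfolding h_def[symmetric] by (simp add: divide_inverse mult.commute)
    then have "norm (\<rho> h) / h * (t * M) < \<epsilon>"
      using t M by (simp add: pos_less_divide_eq)
    moreover have "real (Suc n) = t / h" using h by (simp add: eq_divide_eq)
    ultimately have "real (Suc n) * (M * norm (\<rho> h)) < \<epsilon>" by (simp add: mult_ac)
    moreover obtain m where "m \<in> N"
      "norm (S t x - E t *\<^sub>C x - m) \<le> real (Suc n) * (M * norm (\<rho> h))"
      using step[OF h(1), of "Suc n"] h(2) by auto
    ultimately show ?thesis
      by (intro bexI[of _ m]) (auto simp: dist_norm norm_minus_commute)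
  qed
  then have "S t x - E t *\<^sub>C x \<in> closure N" by (simp add: closure_approachable)
  with N show ?thesis by (simp add: E_def)
qed

end

section \<open>Square integrable functions on the half line\<close>

definition energy_on :: "real set \<Rightarrow> (real \<Rightarrow> 'b::real_normed_vector) \<Rightarrow> ennreal" where
  "energy_on A u = (\<integral>\<^sup>+t. ennreal ((norm (u t))\<^sup>2) \<partial>lebesgue_on A)"

lemma energy_eq: "energy u = energy_on {0..} u"
  by (simp add: energy_def energy_on_def)

lemma complete_measure_interval: "complete_measure (lebesgue_on {0..T::real})"
  by (rule complete_measure_lebesgue_on) simp

lemma energy_on_restrict:
  "A \<in> sets lebesgue \<Longrightarrow> energy_on A u = (\<integral>\<^sup>+t. ennreal ((norm (u t))\<^sup>2) * indicator A t \<partial>lebesgue)"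
  by (simp add: energy_on_def nn_integral_restrict_space)

lemma energy_on_mono:
  assumes "A \<subseteq> B" "A \<in> sets lebesgue" "B \<in> sets lebesgue"
  shows "energy_on A u \<le> energy_on B u"
  using assms by (auto simp: energy_on_restrict indicator_def intro!: nn_integral_mono)

lemma L2_on_iff:
  "u \<in> L2_on T \<longleftrightarrow> strongly_measurable (lebesgue_on {0..T}) u \<and> energy_on {0..T} u < \<infinity>"
proof -
  interpret complete_measure "lebesgue_on {0..T}" by (rule complete_measure_interval)
  have "integrable (lebesgue_on {0..T}) (\<lambda>t. (norm (u t))\<^sup>2) \<longleftrightarrow> energy_on {0..T} u < \<infinity>"
    if "strongly_measurable (lebesgue_on {0..T}) u"
    using borel_measurable_power[OF strongly_measurable_imp_borel_norm[OF that], of 2]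
    by (simp add: integrable_iff_bounded energy_on_def)
  then show ?thesis by (auto simp: L2_on_def)
qed

lemma L2_norm_sq:
  assumes "u \<in> L2_on T"
  shows "ennreal ((L2_norm T u)\<^sup>2) = energy_on {0..T} u"
proof -
  have int: "integrable (lebesgue_on {0..T}) (\<lambda>t. (norm (u t))\<^sup>2)"
    using assms by (simp add: L2_on_def)
  have "energy_on {0..T} u = ennreal (\<integral>t. (norm (u t))\<^sup>2 \<partial>lebesgue_on {0..T})"
    unfolding energy_on_def using int by (intro nn_integral_eq_integral) auto
  then show ?thesis by (simp add: L2_norm_def)
qed

lemma strongly_measurable_indicator:
  assumes "A \<in> sets M" "strongly_measurable M f"
  shows "strongly_measurable M (\<lambda>x. indicator A x *\<^sub>R f x)"
proof -
  from assms(2) obtain s where s: "\<And>i::nat. simple_function M (s i)"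
    and lim: "AE x in M. (\<lambda>i. s i x) \<longlonglongrightarrow> f x"
    unfolding strongly_measurable_def by blast
  from lim have "AE x in M. (\<lambda>i. indicator A x *\<^sub>R s i x) \<longlonglongrightarrow> indicator A x *\<^sub>R f x"
    by eventually_elim (intro tendsto_intros)
  moreover have "simple_function M (\<lambda>x. indicator A x *\<^sub>R s i x)" for i
    by (rule simple_function_compose2[where h="(*\<^sub>R)" and f="indicator A", OF _ s]) (simp add: assms)
  ultimately show ?thesis
    unfolding strongly_measurable_def by (intro exI[of _ "\<lambda>i x. indicator A x *\<^sub>R s i x"]) auto
qed

lemma L2_on_mono:
  assumes "T \<le> T'" "u \<in> L2_on T'"
  shows "u \<in> L2_on T"
proof -
  have "strongly_measurable lebesgue (\<lambda>t. indicator {0..T} t *\<^sub>R (indicator {0..T'} t *\<^sub>R u t))"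
    by (rule strongly_measurable_indicator) (use assms(2) in \<open>auto simp: L2_on_iff strongly_measurable_restrict\<close>)
  also have "(\<lambda>t. indicator {0..T} t *\<^sub>R (indicator {0..T'} t *\<^sub>R u t)) = (\<lambda>t. indicator {0..T} t *\<^sub>R u t)"
    using assms(1) by (auto simp: indicator_def)
  finally have "strongly_measurable (lebesgue_on {0..T}) u"
    by (simp add: strongly_measurable_restrict)
  moreover have "energy_on {0..T} u \<le> energy_on {0..T'} u"
    using assms(1) by (intro energy_on_mono) auto
  ultimately show ?thesis using assms(2) by (auto simp: L2_on_iff)
qed

text \<open>Truncations to [0, n+1] are eventually constant at every point, so measurability on
  bounded intervals passes to the half line. \<open>Suc\<close> keeps the length positive, as
  \<open>L2_loc\<close> requires.\<close>

lemma L2_loc_measurable_norm: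
  assumes "u \<in> L2_loc"
  shows "(\<lambda>t. norm (u t)) \<in> borel_measurable (lebesgue_on {0..})"
proof -
  have "(\<lambda>t. indicator {0..real (Suc n)} t *\<^sub>R norm (u t)) \<in> borel_measurable lebesgue" for n
  proof -
    interpret complete_measure "lebesgue_on {0..real (Suc n)}" by (rule complete_measure_interval)
    have "u \<in> L2_on (real (Suc n))"
      using assms by (simp add: L2_loc_def del: of_nat_Suc)
    then have "(\<lambda>t. norm (u t)) \<in> borel_measurable (lebesgue_on {0..real (Suc n)})"
      by (intro strongly_measurable_imp_borel_norm) (simp add: L2_on_iff)
    then show ?thesis by (subst (asm) borel_measurable_restrict_space_iff) auto
  qed
  then have "(\<lambda>t. indicator {0..} t *\<^sub>R norm (u t)) \<in> borel_measurable lebesgue"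
  proof (rule borel_measurable_LIMSEQ_metric)
    fix t :: real
    obtain m :: nat where m: "t \<le> real m" using real_arch_simple by blast
    have "\<forall>\<^sub>F n in sequentially. indicator {0..real (Suc n)} t *\<^sub>R norm (u t) = indicator {0..} t *\<^sub>R norm (u t)"
      using eventually_ge_at_top[of m] by eventually_elim (use m in \<open>auto simp: indicator_def\<close>)
    then show "(\<lambda>n. indicator {0..real (Suc n)} t *\<^sub>R norm (u t)) \<longlonglongrightarrow> indicator {0..} t *\<^sub>R norm (u t)"
      by (rule tendsto_eventually)
  qed
  then show ?thesis by (subst borel_measurable_restrict_space_iff) auto
qed

lemma L2_loc_measurable_energy:
  assumes "u \<in> L2_loc"
  shows "(\<lambda>t. ennreal ((norm (u t))\<^sup>2)) \<in> borel_measurable (lebesgue_on {0..})"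
  by (intro measurable_compose[OF _ measurable_ennreal] borel_measurable_power L2_loc_measurable_norm assms)

text \<open>A pointwise estimate is integrated once for all; sums, scalings and functions with
  disjoint supports then differ only in the coefficients a and b.\<close>

lemma energy_on_combination_le:
  assumes [measurable]: "(\<lambda>t. norm (u t)) \<in> borel_measurable (lebesgue_on A)"
      "(\<lambda>t. norm (v t)) \<in> borel_measurable (lebesgue_on A)"
    and ab: "a \<ge> 0" "b \<ge> 0"
    and le: "AE t in lebesgue_on A. (norm (w t))\<^sup>2 \<le> a * (norm (u t))\<^sup>2 + b * (norm (v t))\<^sup>2"
  shows "energy_on A w \<le> ennreal a * energy_on A u + ennreal b * energy_on A v"
proof -
  have "energy_on A w \<le> (\<integral>\<^sup>+t. ennreal a * ennreal ((norm (u t))\<^sup>2) + ennreal b * ennreal ((norm (v t))\<^sup>2) \<partial>lebesgue_on A)"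
    unfolding energy_on_def
  proof (rule nn_integral_mono_AE)
    show "AE t in lebesgue_on A. ennreal ((norm (w t))\<^sup>2)
        \<le> ennreal a * ennreal ((norm (u t))\<^sup>2) + ennreal b * ennreal ((norm (v t))\<^sup>2)"
      using le
    proof eventually_elim
      case (elim t)
      then have "ennreal ((norm (w t))\<^sup>2) \<le> ennreal (a * (norm (u t))\<^sup>2 + b * (norm (v t))\<^sup>2)"
        by (rule ennreal_leI)
      with ab show ?case by (simp add: ennreal_mult)
    qed
  qed
  also have "\<dots> = ennreal a * energy_on A u + ennreal b * energy_on A v"
    unfolding energy_on_def by (simp add: nn_integral_add nn_integral_cmult)
  finally show ?thesis .
qed

lemma norm_add_sq_le: "(norm (x + y))\<^sup>2 \<le> 2 * (norm x)\<^sup>2 + 2 * (norm (y::'a::real_normed_vector))\<^sup>2"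
proof -
  have "(norm (x + y))\<^sup>2 \<le> (norm x + norm y)\<^sup>2" by (intro power_mono norm_triangle_ineq) simp
  also have "\<dots> \<le> 2 * (norm x)\<^sup>2 + 2 * (norm y)\<^sup>2"
    using zero_le_power2[of "norm x - norm y"] by (simp add: power2_eq_square algebra_simps)
  finally show ?thesis .
qed

lemma L2_on_measurable_norm:
  assumes "u \<in> L2_on T"
  shows "(\<lambda>t. norm (u t)) \<in> borel_measurable (lebesgue_on {0..T})"
proof -
  interpret complete_measure "lebesgue_on {0..T}" by (rule complete_measure_interval)
  from assms show ?thesis by (intro strongly_measurable_imp_borel_norm) (simp add: L2_on_iff)
qed

lemma L2_on_add:
  assumes "u \<in> L2_on T" "v \<in> L2_on T"
  shows "(\<lambda>t. u t + v t) \<in> L2_on T"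
proof -
  have "energy_on {0..T} (\<lambda>t. u t + v t) \<le> ennreal 2 * energy_on {0..T} u + ennreal 2 * energy_on {0..T} v"
    using assms by (intro energy_on_combination_le L2_on_measurable_norm) (auto intro: norm_add_sq_le)
  also have "\<dots> < \<infinity>" using assms by (simp add: L2_on_iff ennreal_mult_less_top)
  finally show ?thesis using assms by (simp add: L2_on_iff strongly_measurable_add)
qed

lemma L2_on_bounded_linear:
  assumes h: "bounded_linear h" and u: "u \<in> L2_on T"
  shows "(\<lambda>t. h (u t)) \<in> L2_on T"
proof -
  obtain K where K: "\<And>x. norm (h x) \<le> norm x * K"
    using bounded_linear.pos_bounded[OF h] by blast
  have "(norm (h x))\<^sup>2 \<le> K\<^sup>2 * (norm x)\<^sup>2 + 0 * (norm x)\<^sup>2" for x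
    using power_mono[OF K[of x], of 2] by (simp add: power_mult_distrib mult.commute)
  then have "energy_on {0..T} (\<lambda>t. h (u t)) \<le> ennreal (K\<^sup>2) * energy_on {0..T} u + ennreal 0 * energy_on {0..T} u"
    using u by (intro energy_on_combination_le L2_on_measurable_norm) auto
  also have "\<dots> < \<infinity>" using u by (simp add: L2_on_iff ennreal_mult_less_top)
  finally show ?thesis
    using u strongly_measurable_bounded_linear[OF h, of "lebesgue_on {0..T}" u] by (simp add: L2_on_iff)
qed

lemma L2_loc_linear_combination:
  fixes u v :: "real \<Rightarrow> 'b::complex_banach"
  shows "u \<in> L2_loc \<Longrightarrow> v \<in> L2_loc \<Longrightarrow> (\<lambda>t. a *\<^sub>C u t + b *\<^sub>C v t) \<in> L2_loc"
  by (auto simp: L2_loc_def intro!: L2_on_add L2_on_bounded_linear[OF bounded_linear_scaleC_right])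

lemma energy_combination_le:
  assumes "u \<in> L2_loc" "v \<in> L2_loc" "a \<ge> 0" "b \<ge> 0"
    and "AE t in lebesgue_on {0..}. (norm (w t))\<^sup>2 \<le> a * (norm (u t))\<^sup>2 + b * (norm (v t))\<^sup>2"
  shows "energy w \<le> ennreal a * energy u + ennreal b * energy v"
  using assms unfolding energy_eq by (intro energy_on_combination_le L2_loc_measurable_norm)

lemma supported_in_iff: "supported_in T u \<longleftrightarrow> (AE t in lebesgue. 0 \<le> t \<longrightarrow> t > T \<longrightarrow> u t = 0)"
  by (simp add: supported_in_def AE_restrict_space_iff)

lemma supported_in_mono: "supported_in T u \<Longrightarrow> T \<le> T' \<Longrightarrow> supported_in T' u"
  unfolding supported_in_iff by (auto elim: eventually_mono)

lemma energy_finite: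
  assumes "u \<in> L2_loc" "supported_in T u" "T > 0"
  shows "energy u < \<infinity>"
proof -
  have "energy u = energy_on {0..T} u"
    unfolding energy_eq using assms(2)
    by (simp add: energy_on_restrict) (intro nn_integral_cong_AE, auto simp: supported_in_iff indicator_def elim!: eventually_mono)
  also have "\<dots> < \<infinity>" using assms by (auto simp: L2_loc_def L2_on_iff)
  finally show ?thesis .
qed

lemma L2_loc_truncate:
  assumes u: "u \<in> L2_on T" and T: "T > 0"
  shows "(\<lambda>t. if t \<le> T then u t else 0) \<in> L2_loc"
proof -
  define v where "v = (\<lambda>t. if t \<le> T then u t else 0)"
  have v: "v \<in> L2_on T'" if "T' \<ge> T" for T'
  proof -
    have eq: "(\<lambda>t. indicator {0..T'} t *\<^sub>R v t) = (\<lambda>t. indicator {0..T} t *\<^sub>R u t)"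
      using that by (auto simp: v_def indicator_def)
    have "energy_on {0..T'} v = energy_on {0..T} u"
      using that by (auto simp: energy_on_restrict v_def indicator_def intro!: nn_integral_cong)
    then show ?thesis using u by (simp add: L2_on_iff strongly_measurable_restrict eq)
  qed
  have "v \<in> L2_on T'" for T'
    using v[of "max T T'"] L2_on_mono[of T' "max T T'" v] by simp
  then show ?thesis by (simp add: L2_loc_def v_def)
qed

section \<open>Delay by a time \<tau>\<close>

definition shift :: "real \<Rightarrow> (real \<Rightarrow> 'b::zero) \<Rightarrow> real \<Rightarrow> 'b" where
  "shift \<tau> u t = (if t < \<tau> then 0 else u (t - \<tau>))"

lemma nn_integral_lebesgue_translation:
  fixes f :: "real \<Rightarrow> ennreal"
  assumes "f \<in> borel_measurable lebesgue"
  shows "(\<integral>\<^sup>+t. f (c + t) \<partial>lebesgue) = (\<integral>\<^sup>+t. f t \<partial>lebesgue)"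
proof -
  have "integral\<^sup>N (distr lebesgue lebesgue (\<lambda>t. c + t)) f = (\<integral>\<^sup>+t. f (c + t) \<partial>lebesgue)"
    by (rule nn_integral_distr[OF measurable_lebesgue_translation]) (simp add: assms)
  then show ?thesis by (simp only: distr_lebesgue_translation)
qed

text \<open>The last hypothesis says that the part of \<open>B\<close> from \<tau> on is
  \<open>A\<close> translated by \<tau>; it covers bounded intervals and the half line
  alike.\<close>

lemma energy_on_shift:
  assumes A: "A \<in> sets lebesgue" and B: "B \<in> sets lebesgue"
    and u: "(\<lambda>t. norm (u t)) \<in> borel_measurable (lebesgue_on A)"
    and AB: "\<And>t. t \<in> B \<and> \<tau> \<le> t \<longleftrightarrow> t - \<tau> \<in> A"
  shows "energy_on B (shift \<tau> u) = energy_on A u"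
proof -
  have "(\<lambda>t. ennreal ((norm (u t))\<^sup>2)) \<in> borel_measurable (lebesgue_on A)"
    by (intro measurable_compose[OF _ measurable_ennreal] borel_measurable_power u)
  then have m: "(\<lambda>t. ennreal ((norm (u t))\<^sup>2) * indicator A t) \<in> borel_measurable lebesgue"
    using A by (subst (asm) borel_measurable_restrict_space_iff_ennreal) auto
  have "energy_on B (shift \<tau> u) = (\<integral>\<^sup>+t. ennreal ((norm (u (- \<tau> + t)))\<^sup>2) * indicator A (- \<tau> + t) \<partial>lebesgue)"
    unfolding energy_on_restrict[OF B]
  proof (rule nn_integral_cong)
    fix t
    show "ennreal ((norm (shift \<tau> u t))\<^sup>2) * indicator B t
        = ennreal ((norm (u (- \<tau> + t)))\<^sup>2) * indicator A (- \<tau> + t)"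
      using AB[of t] by (auto simp: shift_def indicator_def)
  qed
  also have "\<dots> = energy_on A u"
    unfolding energy_on_restrict[OF A] by (rule nn_integral_lebesgue_translation[OF m])
  finally show ?thesis .
qed

lemma L2_loc_shift:
  assumes u: "u \<in> L2_loc" and \<tau>: "\<tau> \<ge> 0"
  shows "shift \<tau> u \<in> L2_loc"
proof -
  have v: "shift \<tau> u \<in> L2_on (T + \<tau>)" if T: "T > 0" for T
  proof -
    from u T have u': "u \<in> L2_on T" by (simp add: L2_loc_def)
    then have "strongly_measurable lebesgue (\<lambda>t. indicator {0..T} t *\<^sub>R u t)"
      by (simp add: L2_on_iff strongly_measurable_restrict)
    from strongly_measurable_translation[OF this, of "- \<tau>"]
    have "strongly_measurable lebesgue (\<lambda>t. indicator {0..T} (- \<tau> + t) *\<^sub>R u (- \<tau> + t))" .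
    also have "(\<lambda>t. indicator {0..T} (- \<tau> + t) *\<^sub>R u (- \<tau> + t)) = (\<lambda>t. indicator {0..T + \<tau>} t *\<^sub>R shift \<tau> u t)"
      using \<tau> by (auto simp: shift_def indicator_def fun_eq_iff)
    finally have "strongly_measurable (lebesgue_on {0..T + \<tau>}) (shift \<tau> u)"
      by (simp add: strongly_measurable_restrict)
    moreover have "energy_on {0..T + \<tau>} (shift \<tau> u) = energy_on {0..T} u"
      using \<tau> by (intro energy_on_shift L2_on_measurable_norm u') auto
    ultimately show ?thesis using u' by (simp add: L2_on_iff)
  qed
  show ?thesis
    unfolding L2_loc_def
  proof (intro CollectI allI impI)
    fix T :: real assume "T > 0"
    from v[OF this] show "shift \<tau> u \<in> L2_on T" by (rule L2_on_mono[rotated]) (use \<tau> in simp)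
  qed
qed

lemma energy_shift:
  assumes "u \<in> L2_loc" "\<tau> \<ge> 0"
  shows "energy (shift \<tau> u) = energy u"
  unfolding energy_eq using assms(2) by (intro energy_on_shift L2_loc_measurable_norm assms(1)) auto

lemma supported_in_shift:
  assumes "supported_in T u"
  shows "supported_in (T + \<tau>) (shift \<tau> u)"
  using AE_lebesgue_translation[OF assms[unfolded supported_in_iff], of "- \<tau>"]
  unfolding supported_in_iff by eventually_elim (auto simp: shift_def)

lemma (in semigroup_C0) orbit_L2_on:
  assumes T: "T > 0"
  shows "(\<lambda>t. S t x) \<in> L2_on T"
proof -
  \<comment> \<open>The orbit is sampled at the grid point of mesh 1/(n+1) strictly to the right of
    \<open>t\<close>. This takes finitely many values on [0, T], and the added 1 makes the offset
    positive, as \<open>tendsto_right\<close> demands.\<close>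
  let ?s = "\<lambda>n t. S (real_of_int (\<lfloor>t * real (Suc n)\<rfloor> + 1) / real (Suc n)) x"
  have "strongly_measurable (lebesgue_on {0..T}) (\<lambda>t. S t x)"
    unfolding strongly_measurable_def
  proof (intro exI[of _ ?s] conjI allI AE_I2)
    fix n :: nat
    have "simple_function (lebesgue_on {0..T}) (\<lambda>t. \<lfloor>t * real (Suc n)\<rfloor>)"
      unfolding simple_function_def
    proof (intro conjI ballI)
      show "finite ((\<lambda>t. \<lfloor>t * real (Suc n)\<rfloor>) ` space (lebesgue_on {0..T}))"
      proof (rule finite_subset)
        show "(\<lambda>t. \<lfloor>t * real (Suc n)\<rfloor>) ` space (lebesgue_on {0..T}) \<subseteq> {0..\<lfloor>T * real (Suc n)\<rfloor>}"
          by (auto intro!: floor_mono mult_right_mono simp: space_restrict_space simp del: of_nat_Suc)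
      qed simp
      fix k
      have "(\<lambda>t. \<lfloor>t * real (Suc n)\<rfloor>) \<in> measurable borel (count_space UNIV)"
        by measurable
      from measurable_sets[OF this, of "{k}"]
      have "(\<lambda>t. \<lfloor>t * real (Suc n)\<rfloor>) -` {k} \<in> sets lebesgue" by simp
      then show "(\<lambda>t. \<lfloor>t * real (Suc n)\<rfloor>) -` {k} \<inter> space (lebesgue_on {0..T}) \<in> sets (lebesgue_on {0..T})"
        by (auto simp: sets_restrict_space_iff space_restrict_space)
    qed
    then show "simple_function (lebesgue_on {0..T}) (?s n)"
      by (rule simple_function_compose1)
  next
    fix t assume "t \<in> space (lebesgue_on {0..T})"
    then have t: "t \<ge> 0" by (simp add: space_restrict_space)
    define h where "h n = real_of_int (\<lfloor>t * real (Suc n)\<rfloor> + 1) / real (Suc n) - t" for n :: nat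
    have "h n > 0" for n
    proof -
      have "t * real (Suc n) < real_of_int (\<lfloor>t * real (Suc n)\<rfloor> + 1)" by linarith
      then show ?thesis by (simp add: h_def pos_less_divide_eq del: of_nat_Suc)
    qed
    moreover have "h \<longlonglongrightarrow> 0"
    proof (rule tendsto_sandwich[where f="\<lambda>_. 0"])
      show "(\<lambda>n. inverse (real (Suc n))) \<longlonglongrightarrow> 0" by (rule LIMSEQ_inverse_real_of_nat)
      have "h n \<le> inverse (real (Suc n))" for n
      proof -
        have "real_of_int (\<lfloor>t * real (Suc n)\<rfloor> + 1) \<le> t * real (Suc n) + 1" by linarith
        then have "real_of_int (\<lfloor>t * real (Suc n)\<rfloor> + 1) / real (Suc n) \<le> (t * real (Suc n) + 1) / real (Suc n)"
          by (rule divide_right_mono) simp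
        also have "\<dots> = t + inverse (real (Suc n))"
          by (simp add: field_simps)
        finally show ?thesis by (simp add: h_def)
      qed
      then show "\<forall>\<^sub>F n in sequentially. h n \<le> inverse (real (Suc n))" by simp
    qed (use less_imp_le[OF \<open>\<And>n. h n > 0\<close>] in auto)
    ultimately have "(\<lambda>n. S (t + h n) x) \<longlonglongrightarrow> S t x" by (rule tendsto_right[OF t])
    then show "(\<lambda>n. ?s n t) \<longlonglongrightarrow> S t x" by (simp add: h_def del: of_nat_Suc)
  qed
  moreover have "energy_on {0..T} (\<lambda>t. S t x) < \<infinity>"
  proof -
    obtain M where M: "M \<ge> 1" "\<And>t x. t \<in> {0..T} \<Longrightarrow> norm (S t x) \<le> M * norm x"
      using bounded_on_interval[of T] by blast
    have "energy_on {0..T} (\<lambda>t. S t x) \<le> (\<integral>\<^sup>+t. ennreal ((M * norm x)\<^sup>2) \<partial>lebesgue_on {0..T})"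
      unfolding energy_on_def
      by (intro nn_integral_mono ennreal_leI power_mono M) (auto simp: space_restrict_space)
    also have "\<dots> < \<infinity>" using T
      by (simp add: emeasure_restrict_space space_restrict_space ennreal_mult_less_top)
    finally show ?thesis .
  qed
  ultimately show ?thesis by (simp add: L2_on_iff)
qed

text \<open>Cauchy-Schwarz after splitting each weight 2^-k into two equal factors; the 2 bounds the
  sum of the weights.\<close>

lemma norm_geometric_sum_sq_le:
  fixes x :: "nat \<Rightarrow> 'a::real_normed_vector"
  shows "(norm (\<Sum>k<n. (1/2)^k *\<^sub>R x k))\<^sup>2 \<le> 2 * (\<Sum>k<n. (1/2)^k * (norm (x k))\<^sup>2)"
proof -
  define c where "c k = sqrt ((1/2)^k)" for k :: nat
  have c: "c k \<ge> 0" "(c k)\<^sup>2 = (1/2)^k" for k by (simp_all add: c_def)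
  have "norm (\<Sum>k<n. (1/2)^k *\<^sub>R x k) \<le> (\<Sum>k<n. c k * (c k * norm (x k)))"
    by (rule order_trans[OF norm_sum])
      (auto intro!: sum_mono simp: c(2)[symmetric] power2_eq_square mult.assoc c(1))
  then have "(norm (\<Sum>k<n. (1/2)^k *\<^sub>R x k))\<^sup>2 \<le> (\<Sum>k<n. c k * (c k * norm (x k)))\<^sup>2"
    by (intro power_mono) auto
  also have "\<dots> \<le> (\<Sum>k<n. (c k)\<^sup>2) * (\<Sum>k<n. (c k * norm (x k))\<^sup>2)"
    by (rule Cauchy_Schwarz_ineq_sum)
  also have "\<dots> = (\<Sum>k<n. (1/2)^k) * (\<Sum>k<n. (1/2)^k * (norm (x k))\<^sup>2)"
    by (simp only: power_mult_distrib c(2))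
  also have "\<dots> \<le> 2 * (\<Sum>k<n. (1/2)^k * (norm (x k))\<^sup>2)"
  proof (intro mult_right_mono sum_nonneg)
    have "(\<Sum>k<n. (1/2)^k) \<le> (\<Sum>k. (1/2::real)^k)"
      by (intro sum_le_suminf summable_geometric) auto
    also have "\<dots> = 2" by (subst suminf_geometric) auto
    finally show "(\<Sum>k<n. (1/2::real)^k) \<le> 2" .
  qed simp
  finally show ?thesis .
qed

text \<open>The function \<open>W\<close> has integral at most 2, so it is finite almost everywhere,
  which forces absolute convergence. The bound 4 is the factor 2 from Cauchy-Schwarz times the sum 2
  of the weights.\<close>

lemma energy_geometric_series:
  fixes u :: "nat \<Rightarrow> real \<Rightarrow> 'b::banach"
  assumes u: "\<And>k. u k \<in> L2_loc" and e: "\<And>k. energy (u k) \<le> 1"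
  shows "\<exists>v\<in>L2_loc. energy v \<le> 4 \<and> (AE t in lebesgue_on {0..}. (\<lambda>k. (1/2)^k *\<^sub>R u k t) sums v t)"
proof -
  define W where "W t = (\<Sum>k. ennreal ((1/2)^k * (norm (u k t))\<^sup>2))" for t
  have m: "(\<lambda>t. ennreal ((1/2)^k) * ennreal ((norm (u k t))\<^sup>2)) \<in> borel_measurable (lebesgue_on {0..})" for k
    by (intro borel_measurable_times_ennreal L2_loc_measurable_energy u borel_measurable_const)
  have W_eq: "W t = (\<Sum>k. ennreal ((1/2)^k) * ennreal ((norm (u k t))\<^sup>2))" for t
    unfolding W_def by (simp add: ennreal_mult)
  have W_meas: "W \<in> borel_measurable (lebesgue_on {0..})"
    unfolding W_eq[abs_def] by (intro borel_measurable_suminf_order m)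
  have "(\<integral>\<^sup>+t. W t \<partial>lebesgue_on {0..}) = (\<Sum>k. \<integral>\<^sup>+t. ennreal ((1/2)^k) * ennreal ((norm (u k t))\<^sup>2) \<partial>lebesgue_on {0..})"
    unfolding W_eq by (intro nn_integral_suminf m)
  also have "\<dots> = (\<Sum>k. ennreal ((1/2)^k) * energy (u k))"
    unfolding energy_def by (intro suminf_cong nn_integral_cmult L2_loc_measurable_energy u)
  also have "\<dots> \<le> (\<Sum>k. ennreal ((1/2)^k) * 1)"
    by (intro suminf_le mult_left_mono e summableI) auto
  also have "\<dots> = ennreal 2"
    unfolding mult_1_right using geometric_sums[of "1/2::real"] by (intro suminf_ennreal_eq) auto
  finally have W_int: "(\<integral>\<^sup>+t. W t \<partial>lebesgue_on {0..}) \<le> ennreal 2" .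
  then have "AE t in lebesgue_on {0..}. W t \<noteq> \<infinity>"
    by (intro nn_integral_PInf_AE W_meas) (auto simp: top_unique)
  define v where "v t = (\<Sum>k. (1/2)^k *\<^sub>R u k t)" for t
  have ae: "AE t in lebesgue_on {0..}. (\<lambda>k. (1/2)^k *\<^sub>R u k t) sums v t \<and> ennreal ((norm (v t))\<^sup>2) \<le> 2 * W t"
    using \<open>AE t in lebesgue_on {0..}. W t \<noteq> \<infinity>\<close>
  proof eventually_elim
    case (elim t)
    then have sm: "summable (\<lambda>k. (1/2)^k * (norm (u k t))\<^sup>2)"
      unfolding W_def by (intro summable_suminf_not_top) auto
    have "summable (\<lambda>k. (1/2)^k *\<^sub>R u k t)"
    proof (rule summable_comparison_test'[where N=0])
      show "summable (\<lambda>k. (1/2)^k + (1/2)^k * (norm (u k t))\<^sup>2)"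
        by (intro summable_add sm summable_geometric) simp
      fix k :: nat
      \<comment> \<open>The estimate r \<le> 1 + r^2 reduces absolute convergence to summability of
        the weighted squares.\<close>
      have "norm (u k t) \<le> 1 + (norm (u k t))\<^sup>2"
        using zero_le_power2[of "norm (u k t) - 1"] zero_le_power2[of "norm (u k t)"]
        by (simp add: power2_eq_square algebra_simps) (smt (verit) mult_nonneg_nonneg norm_ge_zero)
      then have "(1/2)^k * norm (u k t) \<le> (1/2)^k * (1 + (norm (u k t))\<^sup>2)"
        by (intro mult_left_mono) auto
      then show "norm ((1/2)^k *\<^sub>R u k t) \<le> (1/2)^k + (1/2)^k * (norm (u k t))\<^sup>2"
        by (simp add: distrib_left)
    qed
    then have sums: "(\<lambda>k. (1/2)^k *\<^sub>R u k t) sums v t" unfolding v_def by (rule summable_sums)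
    have "(norm (v t))\<^sup>2 \<le> 2 * (\<Sum>k. (1/2)^k * (norm (u k t))\<^sup>2)"
    proof (rule LIMSEQ_le)
      show "(\<lambda>n. (norm (\<Sum>k<n. (1/2)^k *\<^sub>R u k t))\<^sup>2) \<longlonglongrightarrow> (norm (v t))\<^sup>2"
        using sums unfolding sums_def by (intro tendsto_intros)
      show "(\<lambda>n. 2 * (\<Sum>k<n. (1/2)^k * (norm (u k t))\<^sup>2)) \<longlonglongrightarrow> 2 * (\<Sum>k. (1/2)^k * (norm (u k t))\<^sup>2)"
        using summable_LIMSEQ[OF sm] by (intro tendsto_intros)
    qed (intro exI allI impI norm_geometric_sum_sq_le)
    then have "ennreal ((norm (v t))\<^sup>2) \<le> ennreal (2 * (\<Sum>k. (1/2)^k * (norm (u k t))\<^sup>2))"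
      by (rule ennreal_leI)
    also have "\<dots> = 2 * W t"
      using elim unfolding W_def by (subst suminf_ennreal) (auto simp: ennreal_mult suminf_nonneg sm)
    finally show ?case using sums by blast
  qed
  have "energy v \<le> (\<integral>\<^sup>+t. 2 * W t \<partial>lebesgue_on {0..})"
    unfolding energy_def using ae by (intro nn_integral_mono_AE) (auto elim: eventually_mono)
  also have "\<dots> = 2 * (\<integral>\<^sup>+t. W t \<partial>lebesgue_on {0..})" by (rule nn_integral_cmult[OF W_meas])
  also have "\<dots> \<le> 2 * ennreal 2" by (intro mult_left_mono W_int) simp
  also have "\<dots> = 4" by (simp add: ennreal_numeral[symmetric] ennreal_mult[symmetric] del: ennreal_numeral)
  finally have v4: "energy v \<le> 4" .
  have "v \<in> L2_on T" if T: "T > 0" for T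
  proof -
    interpret complete_measure "lebesgue_on {0..T}" by (rule complete_measure_interval)
    have "strongly_measurable (lebesgue_on {0..T}) v"
    proof (rule strongly_measurable_LIMSEQ)
      show "emeasure (lebesgue_on {0..T}) (space (lebesgue_on {0..T})) < \<infinity>"
        using T by (simp add: emeasure_restrict_space space_restrict_space)
      have "(\<lambda>t. \<Sum>k<n. (1/2)^k *\<^sub>R u k t) \<in> L2_on T" for n
      proof (induction n)
        case 0
        show ?case by (simp add: L2_on_iff strongly_measurable_zero energy_on_def)
      next
        case (Suc n)
        have "(\<lambda>t. (1/2)^n *\<^sub>R u n t) \<in> L2_on T"
          using u[of n] T by (intro L2_on_bounded_linear[OF bounded_linear_scaleR_right]) (simp add: L2_loc_def)
        with Suc show ?case by (simp add: L2_on_add)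
      qed
      then show "strongly_measurable (lebesgue_on {0..T}) (\<lambda>t. \<Sum>k<n. (1/2)^k *\<^sub>R u k t)" for n
        by (simp add: L2_on_iff)
      show "AE t in lebesgue_on {0..T}. (\<lambda>n. \<Sum>k<n. (1/2)^k *\<^sub>R u k t) \<longlonglongrightarrow> v t"
        using ae by (auto simp: AE_restrict_space_iff sums_def elim!: eventually_mono)
    qed
    moreover have "energy_on {0..T} v \<le> energy v"
      unfolding energy_eq by (intro energy_on_mono) auto
    moreover have "(4::ennreal) < \<infinity>" by simp
    ultimately show ?thesis using v4 unfolding L2_on_iff by (meson order.trans le_less_trans)
  qed
  then show ?thesis using v4 ae by (intro bexI[of _ v]) (auto simp: L2_loc_def elim: eventually_mono)
qed

text \<open>The sum of 2^-n |g n|^2 has finite integral, so almost everywhere its terms tend to 0.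
  The geometric factor yields convergence of the whole sequence, where mere decay of L2 norms would
  give it for a subsequence.\<close>

lemma scaled_L2_bounded_tendsto_zero:
  fixes g :: "nat \<Rightarrow> real \<Rightarrow> 'b::real_normed_vector"
  assumes g: "\<And>n. g n \<in> L2_on T" and K: "\<And>n. energy_on {0..T} (g n) \<le> K" "K < \<infinity>"
  shows "AE t in lebesgue_on {0..T}. (\<lambda>n. (1/2)^n *\<^sub>R g n t) \<longlonglongrightarrow> 0"
proof -
  have m: "(\<lambda>t. ennreal ((norm (g n t))\<^sup>2)) \<in> borel_measurable (lebesgue_on {0..T})" for n
    by (intro measurable_compose[OF _ measurable_ennreal] borel_measurable_power L2_on_measurable_norm g)
  have m': "(\<lambda>t. ennreal ((1/2)^n) * ennreal ((norm (g n t))\<^sup>2)) \<in> borel_measurable (lebesgue_on {0..T})" for n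
    by (intro borel_measurable_times_ennreal m borel_measurable_const)
  have "(\<integral>\<^sup>+t. (\<Sum>n. ennreal ((1/2)^n) * ennreal ((norm (g n t))\<^sup>2)) \<partial>lebesgue_on {0..T})
      = (\<Sum>n. \<integral>\<^sup>+t. ennreal ((1/2)^n) * ennreal ((norm (g n t))\<^sup>2) \<partial>lebesgue_on {0..T})"
    by (intro nn_integral_suminf m')
  also have "\<dots> = (\<Sum>n. ennreal ((1/2)^n) * energy_on {0..T} (g n))"
    unfolding energy_on_def by (intro suminf_cong nn_integral_cmult m)
  also have "\<dots> \<le> (\<Sum>n. ennreal ((1/2)^n) * K)"
    by (intro suminf_le mult_left_mono K summableI) auto
  also have "\<dots> = ennreal 2 * K"
  proof -
    have "(\<Sum>n. ennreal ((1/2)^n)) = ennreal 2"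
      using geometric_sums[of "1/2::real"] by (intro suminf_ennreal_eq) auto
    then show ?thesis by (simp only: ennreal_suminf_multc)
  qed
  also have "\<dots> < \<infinity>" using K(2) by (simp add: ennreal_mult_less_top)
  finally have "AE t in lebesgue_on {0..T}. (\<Sum>n. ennreal ((1/2)^n) * ennreal ((norm (g n t))\<^sup>2)) \<noteq> \<infinity>"
    by (intro nn_integral_PInf_AE borel_measurable_suminf_order m') auto
  then show ?thesis
  proof eventually_elim
    case (elim t)
    have "summable (\<lambda>n. (1/2)^n * (norm (g n t))\<^sup>2)"
      using elim by (intro summable_suminf_not_top) (simp_all add: ennreal_mult)
    then have lim: "(\<lambda>n. (1/2)^n * (norm (g n t))\<^sup>2) \<longlonglongrightarrow> 0" by (rule summable_LIMSEQ_zero)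
    have "(\<lambda>n. (norm ((1/2)^n *\<^sub>R g n t))\<^sup>2) \<longlonglongrightarrow> 0"
    proof (rule Lim_null_comparison[OF _ lim], intro always_eventually allI)
      fix n
      have "(norm ((1/2)^n *\<^sub>R g n t))\<^sup>2 = (1/2)^n * ((1/2)^n * (norm (g n t))\<^sup>2)"
        by (simp add: power_mult_distrib power2_eq_square)
      also have "\<dots> \<le> 1 * ((1/2)^n * (norm (g n t))\<^sup>2)"
        by (intro mult_right_mono) (auto simp: power_le_one)
      finally show "norm ((norm ((1/2)^n *\<^sub>R g n t))\<^sup>2) \<le> (1/2)^n * (norm (g n t))\<^sup>2" by simp
    qed
    from tendsto_real_sqrt[OF this] have "(\<lambda>n. norm ((1/2)^n *\<^sub>R g n t)) \<longlonglongrightarrow> 0" by simp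
    then show ?case by (rule tendsto_norm_zero_cancel)
  qed
qed

text \<open>Young's inequality: (p + q)^2 falls short of the weighted sum by (\<delta> p - q)^2 /
  \<delta>. A small \<delta> brings the coefficient of \<open>u\<close> close to |a|^2.\<close>

lemma energy_linear_combination_le:
  fixes u v :: "real \<Rightarrow> 'b::complex_banach"
  assumes u: "u \<in> L2_loc" and v: "v \<in> L2_loc"
    and e: "energy u \<le> ennreal e" "energy v \<le> ennreal f" and nonneg: "e \<ge> 0" "f \<ge> 0" and \<delta>: "\<delta> > 0"
  shows "energy (\<lambda>t. a *\<^sub>C u t + b *\<^sub>C v t)
    \<le> ennreal ((1 + \<delta>) * (cmod a)\<^sup>2 * e + (1 + 1 / \<delta>) * (cmod b)\<^sup>2 * f)"
proof -
  have "energy (\<lambda>t. a *\<^sub>C u t + b *\<^sub>C v t)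
      \<le> ennreal ((1 + \<delta>) * (cmod a)\<^sup>2) * energy u + ennreal ((1 + 1 / \<delta>) * (cmod b)\<^sup>2) * energy v"
  proof (rule energy_combination_le[OF u v])
    show "AE t in lebesgue_on {0..}. (norm (a *\<^sub>C u t + b *\<^sub>C v t))\<^sup>2
        \<le> (1 + \<delta>) * (cmod a)\<^sup>2 * (norm (u t))\<^sup>2 + (1 + 1 / \<delta>) * (cmod b)\<^sup>2 * (norm (v t))\<^sup>2"
    proof (rule AE_I2)
      fix t
      define p q where "p = cmod a * norm (u t)" and "q = cmod b * norm (v t)"
      have "(norm (a *\<^sub>C u t + b *\<^sub>C v t))\<^sup>2 \<le> (p + q)\<^sup>2"
        using norm_triangle_ineq[of "a *\<^sub>C u t" "b *\<^sub>C v t"]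
        by (intro power_mono) (simp_all add: norm_scaleC p_def q_def)
      also have "(p + q)\<^sup>2 = (1 + \<delta>) * p\<^sup>2 + (1 + 1 / \<delta>) * q\<^sup>2 - (\<delta> * p - q)\<^sup>2 / \<delta>"
        using \<delta> by (simp add: field_simps power2_eq_square)
      also have "\<dots> \<le> (1 + \<delta>) * p\<^sup>2 + (1 + 1 / \<delta>) * q\<^sup>2" using \<delta> by simp
      finally show "(norm (a *\<^sub>C u t + b *\<^sub>C v t))\<^sup>2
          \<le> (1 + \<delta>) * (cmod a)\<^sup>2 * (norm (u t))\<^sup>2 + (1 + 1 / \<delta>) * (cmod b)\<^sup>2 * (norm (v t))\<^sup>2"
        by (simp add: p_def q_def power_mult_distrib mult.assoc)
    qed
  qed (use \<delta> in auto)
  also have "\<dots> \<le> ennreal ((1 + \<delta>) * (cmod a)\<^sup>2) * ennreal e + ennreal ((1 + 1 / \<delta>) * (cmod b)\<^sup>2) * ennreal f"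
    by (intro add_mono mult_left_mono e) auto
  also have "\<dots> = ennreal ((1 + \<delta>) * (cmod a)\<^sup>2 * e + (1 + 1 / \<delta>) * (cmod b)\<^sup>2 * f)"
    using \<delta> nonneg by (simp add: ennreal_mult)
  finally show ?thesis .
qed

section \<open>The extrapolation space\<close>

lemma cinner_add_right: "cinner x (y + z) = cinner x y + cinner x (z::'a::complex_hilbert)"
  by (metis cinner_add_left cinner_commute complex_cnj_add)

lemma cinner_scaleC_right: "cinner x (c *\<^sub>C y) = cnj c * cinner x (y::'a::complex_hilbert)"
  by (metis cinner_scaleC_left cinner_commute complex_cnj_mult)

text \<open>Expanding |x + y|^2 and comparing with the triangle inequality, which the norm already
  satisfies, isolates the mixed term.\<close>

lemma Re_cinner_le: "Re (cinner x y) \<le> norm x * norm (y::'a::complex_hilbert)"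
proof -
  have "complex_of_real ((norm (x + y))\<^sup>2)
      = complex_of_real ((norm x)\<^sup>2) + complex_of_real ((norm y)\<^sup>2) + (cinner x y + cnj (cinner x y))"
    unfolding cinner_self[symmetric] cinner_commute[of x y, symmetric] cinner_commute[of y x, symmetric]
    by (simp add: cinner_add_left cinner_add_right)
  then have "(norm (x + y))\<^sup>2 = (norm x)\<^sup>2 + (norm y)\<^sup>2 + 2 * Re (cinner x y)"
    by (simp add: complex_eq_iff del: of_real_power)
  moreover have "(norm (x + y))\<^sup>2 \<le> (norm x + norm y)\<^sup>2"
    by (intro power_mono norm_triangle_ineq) simp
  ultimately show ?thesis by (simp add: power2_sum)
qed

text \<open>Multiplying \<open>x\<close> by a number of modulus 1 makes the inner product real and
  nonnegative.\<close>

lemma norm_cinner_le: "cmod (cinner x y) \<le> norm x * norm (y::'a::complex_hilbert)"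
proof (cases "cinner x y = 0")
  case False
  define c where "c = cnj (cinner x y) / complex_of_real (cmod (cinner x y))"
  have "cinner (c *\<^sub>C x) y = complex_of_real (cmod (cinner x y))"
    using False by (simp add: c_def cinner_scaleC_left mult.commute complex_norm_square[symmetric] power2_eq_square)
  moreover have "cmod c = 1" using False by (simp add: c_def norm_divide)
  ultimately show ?thesis
    using Re_cinner_le[of "c *\<^sub>C x" y] by (simp add: norm_scaleC)
qed simp

lemma bounded_linear_cinner_left: "bounded_linear (\<lambda>x. cinner x (y::'a::complex_hilbert))"
  by (rule bounded_linear_intro[where K="norm y"])
    (simp_all add: cinner_add_left scaleR_scaleC cinner_scaleC_left scaleC_complex_def norm_cinner_le)

lemma bounded_linear_antidual_apply: "bounded_linear (\<lambda>f. antidual_apply f d)"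
  by (rule bounded_linear_intro[where K="norm d"])
    (simp_all add: antidual_apply.rep_eq plus_antidual.rep_eq scaleR_antidual.rep_eq
      norm_antidual.rep_eq blinfun.add_left blinfun.scaleR_left norm_blinfun)

lemma antidual_apply_scaleC: "antidual_apply (c *\<^sub>C f) d = c * antidual_apply f d"
  by (simp add: antidual_apply.rep_eq scaleC_antidual.rep_eq)

lemma antidual_eqI: "(\<And>d. antidual_apply f d = antidual_apply g d) \<Longrightarrow> f = g"
  by transfer (rule blinfun_eqI)

text \<open>Evaluation is legitimate once the functional inside \<open>embed\<close> is known to be
  bounded and antilinear. It is bounded because the graph norm dominates the norm of
  \<open>j d\<close>.\<close>

lemma antidual_apply_embed:
  fixes j :: "'d::complex_hilbert \<Rightarrow> 'h::complex_hilbert"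
  assumes "is_graph_space T j"
  shows "antidual_apply (embed j h) d = cinner h (j d)"
proof -
  have add: "j (d + e) = j d + j e" and scale: "j (c *\<^sub>C d) = c *\<^sub>C j d" for c d e
    using assms by (auto simp: is_graph_space_def)
  have le: "norm (j d) \<le> norm d" for d
  proof -
    from assms have "j d \<in> Domain T" by (auto simp: is_graph_space_def)
    then obtain w where "(j d, w) \<in> T" by blast
    with assms have "norm d = sqrt ((norm (j d))\<^sup>2 + (norm w)\<^sup>2)" by (auto simp: is_graph_space_def)
    then show ?thesis by (simp add: real_le_rsqrt)
  qed
  have bl: "bounded_linear (\<lambda>d. cinner h (j d))"
  proof (rule bounded_linear_intro[where K="norm h"])
    show "norm (cinner h (j d)) \<le> norm d * norm h" for d
      using norm_cinner_le[of h "j d"] mult_left_mono[OF le[of d], of "norm h"] by (simp add: mult.commute)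
  qed (simp_all add: add scale scaleR_scaleC cinner_add_right cinner_scaleC_right scaleC_complex_def)
  have "blinfun_of_antidual (embed j h) = Blinfun (\<lambda>d. cinner h (j d))"
    unfolding embed_def
    by (rule Antidual_inverse) (simp add: bounded_linear_Blinfun_apply[OF bl] scale cinner_scaleC_right)
  then show ?thesis by (simp add: antidual_apply.rep_eq bounded_linear_Blinfun_apply[OF bl])
qed

section \<open>Controls steering to the rest\<close>

locale control_system = semigroup_C0 S
  for S :: "real \<Rightarrow> 'h::complex_hilbert \<Rightarrow> 'h" +
  fixes A :: "'h op_graph" and j :: "'d::complex_hilbert \<Rightarrow> 'h"
    and Se :: "real \<Rightarrow> 'd antidual \<Rightarrow> 'd antidual" and B :: "'u::complex_hilbert \<Rightarrow> 'd antidual"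
  assumes graph: "is_graph_space (adjoint_op A) j"
    and c0_ext: "c0_semigroup Se"
    and B: "bounded_clinear B"
    and L: "\<And>T. T > 0 \<Longrightarrow> L_continuous j Se B T"
begin

abbreviation pairing :: "'h \<Rightarrow> 'd \<Rightarrow> complex" where
  "pairing h d \<equiv> cinner h (j d)"

text \<open>The value at time \<open>t\<close> of the input integral, tested against the elements of \<open>dom A*\<close>.
  Unlike \<open>has_input_value\<close>, it only involves integrals of complex functions; existence of the
  integral in the antidual is supplied by the continuity of \<open>L\<close>.\<close>

definition weak_input :: "(real \<Rightarrow> 'u) \<Rightarrow> real \<Rightarrow> ('d \<Rightarrow> complex) \<Rightarrow> bool" where
  "weak_input u t \<phi> \<longleftrightarrow>
     (\<forall>d. has_bochner_integral (lebesgue_on {0..t}) (\<lambda>s. antidual_apply (Se (t - s) (B (u s))) d) (\<phi> d))"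

lemma input_value_imp_weak:
  assumes "has_input_value Se B u t v"
  shows "weak_input u t (antidual_apply v)"
  unfolding weak_input_def
  using has_strong_integral_bounded_linear[OF complete_measure_interval
      assms[unfolded has_input_value_def] bounded_linear_antidual_apply]
  by blast

lemma weak_input_unique: "weak_input u t \<phi> \<Longrightarrow> weak_input u t \<psi> \<Longrightarrow> \<phi> d = \<psi> d"
  unfolding weak_input_def by (blast intro: has_bochner_integral_eq)

lemma weak_input_linear_combination:
  assumes u: "weak_input u t \<phi>" and v: "weak_input v t \<psi>"
  shows "weak_input (\<lambda>s. a *\<^sub>C u s + b *\<^sub>C v s) t (\<lambda>d. a * \<phi> d + b * \<psi> d)"
  unfolding weak_input_def
proof
  interpret E: semigroup_C0 Se by standard (rule c0_ext)
  fix d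
  let ?f = "\<lambda>u s. antidual_apply (Se (t - s) (B (u s))) d"
  have "has_bochner_integral (lebesgue_on {0..t}) (\<lambda>s. a * ?f u s + b * ?f v s) (a * \<phi> d + b * \<psi> d)"
    using u v unfolding weak_input_def
    by (intro has_bochner_integral_add has_bochner_integral_mult_right) auto
  moreover have "?f (\<lambda>s. a *\<^sub>C u s + b *\<^sub>C v s) s = a * ?f u s + b * ?f v s"
    if "s \<in> space (lebesgue_on {0..t})" for s
  proof -
    have "t - s \<ge> 0" using that by (simp add: space_restrict_space)
    moreover have "B (a *\<^sub>C u s + b *\<^sub>C v s) = a *\<^sub>C B (u s) + b *\<^sub>C B (v s)"
      using B linear_simps(1)[of B] by (simp add: bounded_clinear_def)
    ultimately show ?thesis
      by (simp add: E.add E.scaleC linear_simps(1)[OF bounded_linear_antidual_apply] antidual_apply_scaleC)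
  qed
  ultimately show "has_bochner_integral (lebesgue_on {0..t}) (?f (\<lambda>s. a *\<^sub>C u s + b *\<^sub>C v s)) (a * \<phi> d + b * \<psi> d)"
    by (subst has_bochner_integral_cong[OF refl _ refl, where g="\<lambda>s. a * ?f u s + b * ?f v s"]) auto
qed

lemma weak_input_cong_AE:
  assumes u: "weak_input u t \<phi>" and ae: "AE s in lebesgue_on {0..}. u s = v s"
  shows "weak_input v t \<phi>"
  unfolding weak_input_def
proof
  interpret complete_measure "lebesgue_on {0..t}" by (rule complete_measure_interval)
  fix d
  let ?f = "\<lambda>u s. antidual_apply (Se (t - s) (B (u s))) d"
  from u have int: "has_bochner_integral (lebesgue_on {0..t}) (?f u) (\<phi> d)" by (simp add: weak_input_def)
  have ae': "AE s in lebesgue_on {0..t}. ?f u s = ?f v s"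
    using ae by (auto simp: AE_restrict_space_iff elim: eventually_mono)
  have m: "?f u \<in> borel_measurable (lebesgue_on {0..t})"
    using int by (rule borel_measurable_has_bochner_integral)
  show "has_bochner_integral (lebesgue_on {0..t}) (?f v) (\<phi> d)"
    using int has_bochner_integral_cong_AE[OF m borel_measurable_cong_AE[OF m ae'] ae'] by simp
qed

text \<open>The kernel depends only on t - s, so delaying control and observation time together
  translates the integrand; before \<tau> it vanishes because \<open>B 0 = 0\<close>.\<close>

lemma weak_input_shift:
  assumes u: "weak_input u t \<phi>" and \<tau>: "\<tau> \<ge> 0"
  shows "weak_input (shift \<tau> u) (t + \<tau>) \<phi>"
  unfolding weak_input_def
proof
  interpret E: semigroup_C0 Se by standard (rule c0_ext)
  fix d
  define g where "g s = indicator {0..t + \<tau>} s *\<^sub>R antidual_apply (Se (t + \<tau> - s) (B (shift \<tau> u s))) d" for s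
  define f where "f s = indicator {0..t} s *\<^sub>R antidual_apply (Se (t - s) (B (u s))) d" for s
  have g_eq: "g s = f (- \<tau> + s)" for s
  proof (cases "s < \<tau>")
    case True
    have "B 0 = 0" using B by (auto simp: bounded_clinear_def linear_simps)
    then have "g s = 0"
      using True by (auto simp: g_def shift_def indicator_def E.zero linear_simps(3)[OF bounded_linear_antidual_apply])
    with True show ?thesis by (simp add: f_def)
  next
    case False
    then show ?thesis using \<tau> by (auto simp: g_def f_def shift_def indicator_def algebra_simps)
  qed
  have f: "has_bochner_integral lebesgue f (\<phi> d)"
    using u unfolding weak_input_def f_def by (subst (asm) has_bochner_integral_restrict_space) auto
  have m: "g \<in> borel_measurable lebesgue"
    unfolding g_eq[abs_def]
    by (rule measurable_compose[OF measurable_lebesgue_translation borel_measurable_has_bochner_integral[OF f]])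
  have "has_bochner_integral (distr lebesgue lebesgue (\<lambda>s. \<tau> + s)) g (\<phi> d)"
    by (rule has_bochner_integral_distr[OF m measurable_lebesgue_translation]) (simp add: g_eq f)
  then have "has_bochner_integral lebesgue g (\<phi> d)"
    by (simp only: distr_lebesgue_translation)
  then show "has_bochner_integral (lebesgue_on {0..t + \<tau>})
      (\<lambda>s. antidual_apply (Se (t + \<tau> - s) (B (shift \<tau> u s))) d) (\<phi> d)"
    unfolding g_def by (subst has_bochner_integral_restrict_space) auto
qed

lemma weak_input_embed:
  "has_input_value Se B u t (embed j h) \<Longrightarrow> weak_input u t (pairing h)"
  using input_value_imp_weak[of u t "embed j h"]
  by (simp add: weak_input_def antidual_apply_embed[OF graph])

text \<open>Continuity of \<open>L\<close> in weak form. Energies are squared norms, so the constant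
  is the square of the one for \<open>L\<close>.\<close>

lemma response:
  assumes "T > 0"
  shows "\<exists>C. \<forall>u\<in>L2_on T. \<exists>g\<in>L2_on T. (AE t in lebesgue_on {0..T}. weak_input u t (pairing (g t))) \<and>
      energy_on {0..T} g \<le> ennreal C * energy_on {0..T} u"
proof -
  from L[OF assms] obtain C where C: "\<And>u. u \<in> L2_on T \<Longrightarrow> \<exists>g\<in>L2_on T.
      (AE t in lebesgue_on {0..T}. has_input_value Se B u t (embed j (g t))) \<and> L2_norm T g \<le> C * L2_norm T u"
    unfolding L_continuous_def by blast
  have "\<exists>g\<in>L2_on T. (AE t in lebesgue_on {0..T}. weak_input u t (pairing (g t))) \<and>
      energy_on {0..T} g \<le> ennreal (C\<^sup>2) * energy_on {0..T} u" if u: "u \<in> L2_on T" for u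
  proof -
    from C[OF u] obtain g where g: "g \<in> L2_on T"
      and ae: "AE t in lebesgue_on {0..T}. has_input_value Se B u t (embed j (g t))"
      and le: "L2_norm T g \<le> C * L2_norm T u" by blast
    have "(L2_norm T g)\<^sup>2 \<le> (C * L2_norm T u)\<^sup>2"
      using le by (intro power_mono) (auto simp: L2_norm_def)
    then have "ennreal ((L2_norm T g)\<^sup>2) \<le> ennreal (C\<^sup>2) * ennreal ((L2_norm T u)\<^sup>2)"
      by (simp add: ennreal_mult[symmetric] power_mult_distrib)
    with g ae show ?thesis
      by (auto simp: L2_norm_sq u intro!: bexI[of _ g] elim!: eventually_mono weak_input_embed)
  qed
  then show ?thesis by blast
qed

text \<open>The trajectory itself can be eliminated: it vanishes after \<open>T\<close>, and before \<open>T\<close> it is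
  recovered from \<open>L\<close>.\<close>

lemma steers_iff:
  assumes T: "T > 0"
  shows "steers_to_rest S j Se B T x u \<longleftrightarrow> u \<in> L2_loc \<and> supported_in T u \<and>
    (AE t in lebesgue. t > T \<longrightarrow> weak_input u t (\<lambda>d. - pairing (S t x) d))"
proof (intro iffI conjI; (elim conjE)?)
  assume st: "steers_to_rest S j Se B T x u"
  then show "u \<in> L2_loc" "supported_in T u" by (simp_all add: steers_to_rest_def)
  from st obtain y where y: "is_solution S j Se B x u y" "supported_in T y"
    by (auto simp: steers_to_rest_def)
  from y(1) have "AE t in lebesgue. 0 \<le> t \<longrightarrow> (\<exists>v. has_input_value Se B u t v \<and> embed j (y t) = embed j (S t x) + v)"
    by (simp add: is_solution_def AE_restrict_space_iff)
  with y(2)[unfolded supported_in_iff]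
  show "AE t in lebesgue. t > T \<longrightarrow> weak_input u t (\<lambda>d. - pairing (S t x) d)"
  proof eventually_elim
    case (elim t)
    show ?case
    proof
      assume t: "t > T"
      with elim T obtain v where v: "has_input_value Se B u t v" "embed j 0 = embed j (S t x) + v" by auto
      have "antidual_apply v d = - pairing (S t x) d" for d
      proof -
        have "pairing 0 d = pairing (S t x) d + antidual_apply v d"
          using v(2) by (metis antidual_apply_embed[OF graph] linear_simps(1)[OF bounded_linear_antidual_apply])
        moreover have "pairing 0 d = 0" by (rule linear_simps(3)[OF bounded_linear_cinner_left])
        ultimately show ?thesis by (simp add: eq_neg_iff_add_eq_0 add.commute)
      qed
      with input_value_imp_weak[OF v(1)] show "weak_input u t (\<lambda>d. - pairing (S t x) d)"
        by (simp add: weak_input_def)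
    qed
  qed
next
  assume u: "u \<in> L2_loc" and sup: "supported_in T u"
    and rest: "AE t in lebesgue. t > T \<longrightarrow> weak_input u t (\<lambda>d. - pairing (S t x) d)"
  have ex: "\<exists>g\<in>L2_on T'. AE t in lebesgue. 0 \<le> t \<longrightarrow> t \<le> T' \<longrightarrow> has_input_value Se B u t (embed j (g t))"
    if "T' > 0" for T'
    using L[OF that] u that unfolding L_continuous_def
    by (force simp: L2_loc_def AE_restrict_space_iff elim: eventually_mono)
  \<comment> \<open>One null set has to serve all times; countably many bounded intervals exhaust
    the half line.\<close>
  have "AE t in lebesgue. \<forall>n. 0 \<le> t \<longrightarrow> t \<le> real (Suc n) \<longrightarrow> (\<exists>h. has_input_value Se B u t (embed j h))"
    unfolding AE_all_countable
  proof
    fix n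
    from ex[of "real (Suc n)"] obtain g where "AE t in lebesgue. 0 \<le> t \<longrightarrow> t \<le> real (Suc n) \<longrightarrow> has_input_value Se B u t (embed j (g t))"
      by (auto simp del: of_nat_Suc)
    then show "AE t in lebesgue. 0 \<le> t \<longrightarrow> t \<le> real (Suc n) \<longrightarrow> (\<exists>h. has_input_value Se B u t (embed j h))"
      by eventually_elim blast
  qed
  moreover from ex[OF T] obtain g where g: "g \<in> L2_on T"
    and g': "AE t in lebesgue. 0 \<le> t \<longrightarrow> t \<le> T \<longrightarrow> has_input_value Se B u t (embed j (g t))" by blast
  \<comment> \<open>Here \<open>g\<close> is the response on [0, T]; after T the value 0 is imposed
    and justified by the weak condition.\<close>
  define y where "y t = (if t \<le> T then S t x + g t else 0)" for t
  have "y \<in> L2_loc"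
    unfolding y_def[abs_def] by (intro L2_loc_truncate L2_on_add orbit_L2_on g T)
  moreover have "supported_in T y" by (simp add: supported_in_iff y_def)
  moreover have "AE t in lebesgue. 0 \<le> t \<longrightarrow> (\<exists>v. has_input_value Se B u t v \<and> embed j (y t) = embed j (S t x) + v)"
    using calculation(1) g' rest
  proof eventually_elim
    case (elim t)
    show ?case
    proof
      assume t: "0 \<le> t"
      show "\<exists>v. has_input_value Se B u t v \<and> embed j (y t) = embed j (S t x) + v"
      proof (cases "t \<le> T")
        case True
        have "embed j (S t x + g t) = embed j (S t x) + embed j (g t)"
          by (rule antidual_eqI)
            (simp add: antidual_apply_embed[OF graph] linear_simps(1)[OF bounded_linear_antidual_apply] cinner_add_left)
        with True t elim show ?thesis by (auto simp: y_def)
      next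
        case False
        obtain n :: nat where "t \<le> real n" using real_arch_simple by blast
        then have "t \<le> real (Suc n)" by simp
        with elim t obtain h where h: "has_input_value Se B u t (embed j h)" by blast
        \<comment> \<open>The value \<open>h\<close> supplied by \<open>L\<close> is compared with
          -S t x only through pairings, which suffices for the solution formula with state
          0.\<close>
        have "pairing h d = - pairing (S t x) d" for d
          using False elim by (intro weak_input_unique[OF weak_input_embed[OF h]]) auto
        then have "embed j 0 = embed j (S t x) + embed j h"
          by (intro antidual_eqI)
            (simp add: antidual_apply_embed[OF graph] linear_simps(1)[OF bounded_linear_antidual_apply]
              linear_simps(3)[OF bounded_linear_cinner_left])
        with False h show ?thesis by (auto simp: y_def)
      qed
    qed
  qed
  ultimately show "steers_to_rest S j Se B T x u"
    using u sup by (auto simp: steers_to_rest_def is_solution_def AE_restrict_space_iff)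
qed

section \<open>Operations on steering controls\<close>

abbreviation steers :: "real \<Rightarrow> 'h \<Rightarrow> (real \<Rightarrow> 'u) \<Rightarrow> bool" where
  "steers \<equiv> steers_to_rest S j Se B"

lemma steers_linear_combination:
  assumes T: "T > 0" and u: "steers T x u" and v: "steers T y v"
  shows "steers T (a *\<^sub>C x + b *\<^sub>C y) (\<lambda>t. a *\<^sub>C u t + b *\<^sub>C v t)"
  unfolding steers_iff[OF T]
proof (intro conjI)
  from u v show "(\<lambda>t. a *\<^sub>C u t + b *\<^sub>C v t) \<in> L2_loc"
    by (auto simp: steers_iff[OF T] intro: L2_loc_linear_combination)
  have "AE t in lebesgue. 0 \<le> t \<longrightarrow> t > T \<longrightarrow> u t = 0" "AE t in lebesgue. 0 \<le> t \<longrightarrow> t > T \<longrightarrow> v t = 0"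
    using u v by (auto simp: steers_iff[OF T] supported_in_iff)
  then show "supported_in T (\<lambda>t. a *\<^sub>C u t + b *\<^sub>C v t)"
    unfolding supported_in_iff by eventually_elim simp
  have "AE t in lebesgue. t > T \<longrightarrow> weak_input u t (\<lambda>d. - pairing (S t x) d)"
    "AE t in lebesgue. t > T \<longrightarrow> weak_input v t (\<lambda>d. - pairing (S t y) d)"
    using u v by (auto simp: steers_iff[OF T])
  then show "AE t in lebesgue. t > T \<longrightarrow>
      weak_input (\<lambda>t. a *\<^sub>C u t + b *\<^sub>C v t) t (\<lambda>d. - pairing (S t (a *\<^sub>C x + b *\<^sub>C y)) d)"
  proof eventually_elim
    case (elim t)
    show ?case
    proof
      assume t: "t > T"
      have eq: "(\<lambda>d. - pairing (S t (a *\<^sub>C x + b *\<^sub>C y)) d)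
          = (\<lambda>d. a * (- pairing (S t x) d) + b * (- pairing (S t y) d))"
        using t T by (simp add: add scaleC cinner_add_left cinner_scaleC_left)
      show "weak_input (\<lambda>t. a *\<^sub>C u t + b *\<^sub>C v t) t (\<lambda>d. - pairing (S t (a *\<^sub>C x + b *\<^sub>C y)) d)"
        unfolding eq using elim t by (intro weak_input_linear_combination) auto
    qed
  qed
qed

lemma steers_mono:
  assumes "0 < T" "T \<le> T'" "steers T x u"
  shows "steers T' x u"
proof -
  have T': "T' > 0" using assms by simp
  show ?thesis
    using assms(3) unfolding steers_iff[OF assms(1)] steers_iff[OF T']
    using assms(2) by (auto intro: supported_in_mono elim: eventually_mono)
qed

text \<open>At time t the delayed control has the input value of \<open>u\<close> at t - \<tau>, and
  \<open>S (t - \<tau>) (S \<tau> x) = S t x\<close>.\<close>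

lemma steers_shift:
  assumes T: "T > 0" and \<tau>: "\<tau> \<ge> 0" and u: "steers T (S \<tau> x) u"
  shows "steers (T + \<tau>) x (shift \<tau> u)"
proof -
  from T \<tau> have T': "T + \<tau> > 0" by simp
  have "AE t in lebesgue. t > T \<longrightarrow> weak_input u t (\<lambda>d. - pairing (S t (S \<tau> x)) d)"
    using u by (simp add: steers_iff[OF T])
  from AE_lebesgue_translation[OF this, of "- \<tau>"]
  have "AE t in lebesgue. t > T + \<tau> \<longrightarrow> weak_input (shift \<tau> u) t (\<lambda>d. - pairing (S t x) d)"
  proof eventually_elim
    case (elim t)
    show ?case
    proof
      assume t: "t > T + \<tau>"
      with elim have "weak_input u (- \<tau> + t) (\<lambda>d. - pairing (S (- \<tau> + t) (S \<tau> x)) d)" by simp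
      from weak_input_shift[OF this \<tau>]
      have "weak_input (shift \<tau> u) t (\<lambda>d. - pairing (S (- \<tau> + t) (S \<tau> x)) d)" by simp
      moreover have "S (- \<tau> + t) (S \<tau> x) = S t x"
        using semigroup[of "- \<tau> + t" \<tau> x] t T \<tau> by simp
      ultimately show "weak_input (shift \<tau> u) t (\<lambda>d. - pairing (S t x) d)" by simp
    qed
  qed
  with u show ?thesis
    unfolding steers_iff[OF T'] by (auto simp: steers_iff[OF T] \<tau> intro: L2_loc_shift supported_in_shift)
qed

lemma steers_partial_sums:
  assumes T: "T > 0" and u: "\<And>k. steers T (x k) (u k)"
  shows "steers T (\<Sum>k<n. (1/2)^k *\<^sub>R x k) (\<lambda>t. \<Sum>k<n. (1/2)^k *\<^sub>R u k t)"
proof (induction n)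
  case 0
  from steers_linear_combination[OF T u[of 0] u[of 0], of 0 0] show ?case by simp
next
  case (Suc n)
  \<comment> \<open>The zero state and zero control arise as a combination with both coefficients
    0.\<close>
  from steers_linear_combination[OF T Suc u[of n], of 1 "complex_of_real ((1/2)^n)"]
  show ?case by (simp only: scaleR_scaleC[symmetric] scaleC_one sum.lessThan_Suc)
qed

text \<open>Convergence of the partial sums \<open>U n\<close> in energy would not control the input
  at a given time. Instead the limit control is split as \<open>U n\<close> + 2^-n
  \<open>r n\<close>. The responses to \<open>r n\<close> are bounded in L2 on each bounded window,
  so with the factor 2^-n they tend to 0 almost everywhere, while the response to \<open>U n\<close>
  is -S t (X n), which converges.\<close>

lemma steers_series:
  assumes T: "T > 0" and u: "\<And>k. steers T (x k) (u k)" and e: "\<And>k. energy (u k) \<le> 1"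
    and x: "(\<lambda>k. (1/2)^k *\<^sub>R x k) sums z"
  shows "\<exists>v. steers T z v \<and> energy v \<le> 4"
proof -
  have L2: "u k \<in> L2_loc" for k using u by (simp add: steers_iff[OF T])
  \<comment> \<open>The series is restarted at index n with an energy bound independent of n; n = 0
    gives the limit control.\<close>
  have series: "\<exists>r\<in>L2_loc. energy r \<le> 4 \<and> (AE t in lebesgue_on {0..}. (\<lambda>k. (1/2)^k *\<^sub>R u (k + n) t) sums r t)" for n
    by (rule energy_geometric_series[where u="\<lambda>k. u (k + n)", OF L2 e])
  from series[of 0] obtain v where v: "v \<in> L2_loc" "energy v \<le> 4"
    and v_sums: "AE t in lebesgue_on {0..}. (\<lambda>k. (1/2)^k *\<^sub>R u k t) sums v t"
    unfolding add_0_right by (elim bexE conjE) (rule that)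
  from series obtain r where r: "\<And>n. r n \<in> L2_loc" "\<And>n. energy (r n) \<le> 4"
    and r_sums: "\<And>n. AE t in lebesgue_on {0..}. (\<lambda>k. (1/2)^k *\<^sub>R u (k + n) t) sums r n t" by metis
  define U where "U n t = (\<Sum>k<n. (1/2)^k *\<^sub>R u k t)" for n t
  define X where "X n = (\<Sum>k<n. (1/2)^k *\<^sub>R x k)" for n
  have split: "AE t in lebesgue_on {0..}. 1 *\<^sub>C U n t + complex_of_real ((1/2)^n) *\<^sub>C r n t = v t" for n
    using v_sums r_sums[of n]
  proof eventually_elim
    case (elim t)
    have "(\<lambda>k. (1/2)^n *\<^sub>R (1/2)^k *\<^sub>R u (k + n) t) sums ((1/2)^n *\<^sub>R r n t)"
      by (rule sums_scaleR_right[OF elim(2)])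
    then have "(\<lambda>k. (1/2)^(k + n) *\<^sub>R u (k + n) t) sums ((1/2)^n *\<^sub>R r n t)"
      by (simp add: power_add mult.commute)
    moreover have "(\<lambda>k. (1/2)^(k + n) *\<^sub>R u (k + n) t) sums (v t - U n t)"
      unfolding U_def by (rule sums_split_initial_segment[OF elim(1)])
    ultimately have "(1/2)^n *\<^sub>R r n t = v t - U n t" by (rule sums_unique2)
    then show ?case by (simp only: scaleC_one scaleR_scaleC[symmetric]) (simp add: algebra_simps)
  qed
  have "AE t in lebesgue_on {0..}. \<forall>k. t > T \<longrightarrow> u k t = 0"
    unfolding AE_all_countable using u by (simp add: steers_iff[OF T] supported_in_def)
  with v_sums have sup: "supported_in T v"
    unfolding supported_in_def by eventually_elim (auto dest: sums_unique)
  \<comment> \<open>The response constant depends on the window, so the condition is first proved up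
    to an arbitrary time \<open>T'\<close>.\<close>
  have rest: "AE t in lebesgue. t > T \<longrightarrow> t \<le> T' \<longrightarrow> weak_input v t (\<lambda>d. - pairing (S t z) d)"
    if T': "T' > 0" for T'
  proof -
    obtain C where C: "\<And>u. u \<in> L2_on T' \<Longrightarrow> \<exists>g\<in>L2_on T'.
        (AE t in lebesgue_on {0..T'}. weak_input u t (pairing (g t))) \<and>
        energy_on {0..T'} g \<le> ennreal C * energy_on {0..T'} u"
      using response[OF T'] by blast
    from v(1) T' have "v \<in> L2_on T'" by (simp add: L2_loc_def)
    from C[OF this] obtain g where g: "AE t in lebesgue_on {0..T'}. weak_input v t (pairing (g t))"
      by (elim bexE conjE) (rule that)
    have "r n \<in> L2_on T'" for n using r(1) T' by (simp add: L2_loc_def)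
    define P where "P n h \<longleftrightarrow> h \<in> L2_on T' \<and> (AE t in lebesgue_on {0..T'}. weak_input (r n) t (pairing (h t))) \<and>
        energy_on {0..T'} h \<le> ennreal C * energy_on {0..T'} (r n)" for n h
    have "\<exists>h. P n h" for n
      using C[OF \<open>r n \<in> L2_on T'\<close>] unfolding P_def Bex_def .
    then obtain h where "\<And>n. P n (h n)" by metis
    then have h: "\<And>n. h n \<in> L2_on T'"
      and h_weak: "\<And>n. AE t in lebesgue_on {0..T'}. weak_input (r n) t (pairing (h n t))"
      and h_le: "\<And>n. energy_on {0..T'} (h n) \<le> ennreal C * energy_on {0..T'} (r n)"
      by (simp_all add: P_def)
    have "energy_on {0..T'} (h n) \<le> ennreal C * 4" for n
    proof -
      have "energy_on {0..T'} (r n) \<le> energy (r n)" unfolding energy_eq by (intro energy_on_mono) auto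
      with r(2)[of n] have "energy_on {0..T'} (r n) \<le> 4" by (rule order_trans[rotated])
      then show ?thesis using h_le[of n] by (meson mult_left_mono order_trans zero_le)
    qed
    then have h_lim: "AE t in lebesgue_on {0..T'}. (\<lambda>n. (1/2)^n *\<^sub>R h n t) \<longlonglongrightarrow> 0"
      by (rule scaled_L2_bounded_tendsto_zero[OF h]) (simp add: ennreal_mult_less_top)
    have "AE t in lebesgue. \<forall>n. t > T \<longrightarrow> weak_input (U n) t (\<lambda>d. - pairing (S t (X n)) d)"
      unfolding AE_all_countable
    proof
      fix n
      show "AE t in lebesgue. t > T \<longrightarrow> weak_input (U n) t (\<lambda>d. - pairing (S t (X n)) d)"
        using steers_partial_sums[where u=u and x=x and n=n, OF T u] unfolding U_def X_def steers_iff[OF T] by blast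
    qed
    moreover have "AE t in lebesgue. \<forall>n. 0 \<le> t \<and> t \<le> T' \<longrightarrow> weak_input (r n) t (pairing (h n t))"
      unfolding AE_all_countable using h_weak by (simp add: AE_restrict_space_iff)
    moreover have "AE t in lebesgue. 0 \<le> t \<and> t \<le> T' \<longrightarrow> weak_input v t (pairing (g t))"
      using g by (simp add: AE_restrict_space_iff)
    moreover have "AE t in lebesgue. 0 \<le> t \<and> t \<le> T' \<longrightarrow> (\<lambda>n. (1/2)^n *\<^sub>R h n t) \<longlonglongrightarrow> 0"
      using h_lim by (simp add: AE_restrict_space_iff)
    ultimately show ?thesis
    proof eventually_elim
      case (elim t)
      show ?case
      proof (intro impI)
        assume t: "t > T" "t \<le> T'"
        with T have t0: "t \<ge> 0" by simp
        \<comment> \<open>By the splitting, the right-hand side does not depend on n and therefore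
          equals its limit.\<close>
        have eq: "pairing (g t) d = pairing (- S t (X n) + (1/2)^n *\<^sub>R h n t) d" for n d
        proof -
          have "weak_input (\<lambda>s. 1 *\<^sub>C U n s + complex_of_real ((1/2)^n) *\<^sub>C r n s) t
              (\<lambda>d. 1 * - pairing (S t (X n)) d + complex_of_real ((1/2)^n) * pairing (h n t) d)"
            using elim t t0 by (intro weak_input_linear_combination) auto
          from weak_input_cong_AE[OF this split]
          have "pairing (g t) d = 1 * - pairing (S t (X n)) d + complex_of_real ((1/2)^n) * pairing (h n t) d"
            using elim t t0 by (intro weak_input_unique[where \<phi>="pairing (g t)" and u=v]) auto
          also have "\<dots> = pairing (- S t (X n)) d + pairing ((1/2)^n *\<^sub>R h n t) d"
            unfolding scaleR_scaleC cinner_scaleC_left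
            by (simp add: linear_simps(4)[OF bounded_linear_cinner_left])
          finally show ?thesis by (simp only: cinner_add_left)
        qed
        have X: "X \<longlonglongrightarrow> z" using x unfolding sums_def X_def .
        have "pairing (g t) d = - pairing (S t z) d" for d
        proof -
          have "(\<lambda>n. - S t (X n) + (1/2)^n *\<^sub>R h n t) \<longlonglongrightarrow> - S t z + 0"
            using elim t t0 by (intro tendsto_add tendsto_minus bounded_linear.tendsto[OF bounded_linear X]) auto
          then have "(\<lambda>n. pairing (- S t (X n) + (1/2)^n *\<^sub>R h n t) d) \<longlonglongrightarrow> pairing (- S t z + 0) d"
            by (rule bounded_linear.tendsto[OF bounded_linear_cinner_left])
          then have "(\<lambda>n::nat. pairing (g t) d) \<longlonglongrightarrow> pairing (- S t z + 0) d"
            by (simp only: eq[symmetric])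
          then have "pairing (g t) d = pairing (- S t z + 0) d" by (simp only: LIMSEQ_const_iff)
          then show ?thesis by (simp add: linear_simps(4)[OF bounded_linear_cinner_left])
        qed
        moreover have "weak_input v t (pairing (g t))" using elim t t0 by simp
        ultimately show "weak_input v t (\<lambda>d. - pairing (S t z) d)" by (simp add: weak_input_def)
      qed
    qed
  qed
  have "AE t in lebesgue. \<forall>n. t > T \<longrightarrow> t \<le> real (Suc n) \<longrightarrow> weak_input v t (\<lambda>d. - pairing (S t z) d)"
    unfolding AE_all_countable
  proof
    show "AE t in lebesgue. t > T \<longrightarrow> t \<le> real (Suc n) \<longrightarrow> weak_input v t (\<lambda>d. - pairing (S t z) d)" for n
      by (rule rest) simp
  qed
  then have "AE t in lebesgue. t > T \<longrightarrow> weak_input v t (\<lambda>d. - pairing (S t z) d)"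
  proof eventually_elim
    case (elim t)
    obtain n :: nat where "t \<le> real n" using real_arch_simple by blast
    then have "t \<le> real (Suc n)" by simp
    with elim show ?case by blast
  qed
  with v sup show ?thesis unfolding steers_iff[OF T] by blast
qed

lemma steers_scaleC:
  assumes T: "T > 0" and u: "steers T x u" and e: "energy u \<le> ennreal e" "e \<ge> 0"
  shows "steers T (c *\<^sub>C x) (\<lambda>t. c *\<^sub>C u t) \<and> energy (\<lambda>t. c *\<^sub>C u t) \<le> ennreal ((cmod c)\<^sup>2 * e)"
proof
  from steers_linear_combination[OF T u u, of c 0] show "steers T (c *\<^sub>C x) (\<lambda>t. c *\<^sub>C u t)" by simp
  have L2: "u \<in> L2_loc" using u by (simp add: steers_iff[OF T])
  have "energy (\<lambda>t. c *\<^sub>C u t) \<le> ennreal ((cmod c)\<^sup>2) * energy u + ennreal 0 * energy u"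
    by (rule energy_combination_le[OF L2 L2]) (simp_all add: norm_scaleC power_mult_distrib)
  also have "\<dots> \<le> ennreal ((cmod c)\<^sup>2) * ennreal e"
    using e(1) by (simp add: mult_left_mono)
  finally show "energy (\<lambda>t. c *\<^sub>C u t) \<le> ennreal ((cmod c)\<^sup>2 * e)" using e(2) by (simp add: ennreal_mult)
qed

text \<open>Scaling a state by c scales energies by c^2. Hence the energy 4 from
  \<open>steers_series\<close> drops to 1 under halving, so \<open>D\<close> meets the hypotheses of
  the absorption lemma and contains a ball; scaling again gives the quadratic bound.\<close>

lemma null_controllable_bounded_energy:
  assumes T: "T > 0" and nc: "null_controllable S j Se B T"
  shows "\<exists>C\<ge>0. \<forall>x. \<exists>u. steers T x u \<and> energy u \<le> ennreal (C * (norm x)\<^sup>2)"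
proof -
  define D where "D = {x. \<exists>u. steers T x u \<and> energy u \<le> ennreal 1}"
  have "\<exists>r>0. \<forall>x. norm x \<le> r \<longrightarrow> x \<in> D"
  proof (rule absorbing_series_closed_contains_cball)
    fix x
    from nc obtain u where u: "steers T x u" by (auto simp: null_controllable_def)
    then have "energy u < \<infinity>" by (intro energy_finite[OF _ _ T]) (auto simp: steers_iff[OF T])
    then obtain e where e: "energy u = ennreal e" "e \<ge> 0" by (cases "energy u") auto
    obtain n :: nat where n: "e \<le> real n" using real_arch_simple by blast
    define c where "c = inverse (1 + real n)"
    have c: "0 < c" "c \<le> 1" "c * (1 + real n) = 1" by (simp_all add: c_def divide_simps)
    have "steers T (complex_of_real c *\<^sub>C x) (\<lambda>t. complex_of_real c *\<^sub>C u t)"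
      and le: "energy (\<lambda>t. complex_of_real c *\<^sub>C u t) \<le> ennreal (c\<^sup>2 * e)"
      using steers_scaleC[OF T u _ e(2), of "complex_of_real c"] e(1) by auto
    moreover have "c\<^sup>2 * e \<le> 1"
    proof -
      have "c\<^sup>2 * e \<le> c * (c * (1 + real n))"
        unfolding power2_eq_square mult.assoc using c n by (intro mult_left_mono) auto
      with c show ?thesis by simp
    qed
    ultimately have "complex_of_real c *\<^sub>C x \<in> D"
      unfolding D_def by (blast intro: order_trans ennreal_leI)
    then show "\<exists>n::nat. x /\<^sub>R (1 + real n) \<in> D"
      by (intro exI[of _ n]) (simp add: c_def scaleR_scaleC)
  next
    fix x y assume "x \<in> D" "y \<in> D"
    then obtain u v where uv: "steers T x u" "energy u \<le> ennreal 1" "steers T y v" "energy v \<le> ennreal 1"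
      by (auto simp: D_def)
    from steers_linear_combination[OF T uv(1,3), of "1/2" "-1/2"]
    have "steers T ((x - y) /\<^sub>R 2) (\<lambda>t. (1/2) *\<^sub>C u t + (-1/2) *\<^sub>C v t)"
      using scaleC_diff_left[of 0 "1/2" y] by (simp add: scaleR_scaleC scaleC_diff_right)
    \<comment> \<open>With \<delta> = 1 each control contributes 2 times 1/4.\<close>
    moreover have "energy (\<lambda>t. (1/2) *\<^sub>C u t + (-1/2) *\<^sub>C v t) \<le> ennreal 1"
      using energy_linear_combination_le[OF _ _ uv(2,4), of 1 "1/2" "-1/2"] uv
      by (simp add: steers_iff[OF T] power2_eq_square)
    ultimately show "(x - y) /\<^sub>R 2 \<in> D" by (auto simp: D_def)
  next
    fix x :: "nat \<Rightarrow> 'h" and y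
    assume "\<And>k. x k \<in> D" and y: "(\<lambda>k. (1/2)^k *\<^sub>R x k) sums y"
    then obtain u where u: "\<And>k. steers T (x k) (u k)" "\<And>k. energy (u k) \<le> ennreal 1"
      unfolding D_def mem_Collect_eq by metis
    with steers_series[OF T u(1) _ y] obtain v where v: "steers T y v" "energy v \<le> ennreal 4" by auto
    from steers_scaleC[OF T v, of "1/2"]
    show "y /\<^sub>R 2 \<in> D" by (auto simp: D_def scaleR_scaleC power2_eq_square)
  qed
  then obtain r where r: "r > 0" "\<And>x. norm x \<le> r \<Longrightarrow> x \<in> D" by blast
  have "\<exists>u. steers T x u \<and> energy u \<le> ennreal (1 / r\<^sup>2 * (norm x)\<^sup>2)" for x
  proof -
    \<comment> \<open>A nonzero \<open>x\<close> is c times a vector of norm r, and energy 1 scales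
      to c^2 = |x|^2 / r^2.\<close>
    define c where "c = norm x / r"
    define z where "z = (if x = 0 then 0 else x /\<^sub>R c)"
    have "norm z \<le> r" using r(1) by (simp add: z_def c_def)
    then obtain u where u: "steers T z u" "energy u \<le> ennreal 1" using r(2) by (auto simp: D_def)
    have x: "x = complex_of_real c *\<^sub>C z"
    proof -
      have "x = c *\<^sub>R z" using r(1) by (simp add: z_def c_def)
      then show ?thesis by (simp only: scaleR_scaleC)
    qed
    from steers_scaleC[OF T u, of "complex_of_real c"]
    show ?thesis unfolding x[symmetric] by (auto simp: c_def norm_divide power_divide)
  qed
  then show ?thesis by (intro exI[of _ "1 / r\<^sup>2"]) auto
qed

end

section \<open>The cost of steering to the rest\<close>

context control_system
begin

text \<open>The time is left free, so waiting costs nothing. The condition e \<ge> 0 matters because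
  \<open>ennreal\<close> sends negative numbers to 0.\<close>

definition steered_with :: "real \<Rightarrow> 'h \<Rightarrow> bool" where
  "steered_with e x \<longleftrightarrow> e \<ge> 0 \<and> (\<exists>T>0. \<exists>u. steers T x u \<and> energy u \<le> ennreal e)"

lemma steered_with_shift:
  assumes "t \<ge> 0" "steered_with e (S t x)"
  shows "steered_with e x"
proof -
  from assms obtain T u where T: "T > 0" and u: "steers T (S t x) u" "energy u \<le> ennreal e" and e: "e \<ge> 0"
    by (auto simp: steered_with_def)
  then have "u \<in> L2_loc" by (simp add: steers_iff[OF T])
  with u have "energy (shift t u) \<le> ennreal e" by (simp add: energy_shift assms(1))
  with steers_shift[OF T assms(1) u(1)] e T assms(1) show ?thesis
    unfolding steered_with_def by (intro conjI exI[of _ "T + t"] exI[of _ "shift t u"]) auto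
qed

lemma steered_with_add:
  assumes x: "steered_with e x" and y: "steered_with f y" and \<delta>: "\<delta> > 0"
  shows "steered_with ((1 + \<delta>) * e + (1 + 1 / \<delta>) * f) (x + y)"
proof -
  from x obtain T u where T: "T > 0" and u: "steers T x u" "energy u \<le> ennreal e" and e: "e \<ge> 0"
    by (auto simp: steered_with_def)
  from y obtain T' v where T': "T' > 0" and v: "steers T' y v" "energy v \<le> ennreal f" and f: "f \<ge> 0"
    by (auto simp: steered_with_def)
  define R where "R = max T T'"
  have R: "R > 0" using T by (simp add: R_def)
  have u': "steers R x u" by (rule steers_mono[OF T _ u(1)]) (simp add: R_def)
  have v': "steers R y v" by (rule steers_mono[OF T' _ v(1)]) (simp add: R_def)
  from steers_linear_combination[OF R u' v', of 1 1]
  have "steers R (x + y) (\<lambda>t. 1 *\<^sub>C u t + 1 *\<^sub>C v t)" by simp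
  moreover have "energy (\<lambda>t. 1 *\<^sub>C u t + 1 *\<^sub>C v t) \<le> ennreal ((1 + \<delta>) * e + (1 + 1 / \<delta>) * f)"
    using energy_linear_combination_le[OF _ _ u(2) v(2) e f \<delta>, of 1 1] u' v'
    by (simp add: steers_iff[OF R])
  moreover have "(1 + \<delta>) * e + (1 + 1 / \<delta>) * f \<ge> 0" using e f \<delta> by simp
  ultimately show ?thesis using R unfolding steered_with_def by blast
qed

lemma steered_with_scaleC: "steered_with e x \<Longrightarrow> steered_with ((cmod c)\<^sup>2 * e) (c *\<^sub>C x)"
  unfolding steered_with_def using steers_scaleC by (metis mult_nonneg_nonneg zero_le_power2)

text \<open>First follow \<open>\<epsilon> u\<close>, which leads \<open>x\<close> to \<open>(1 - \<epsilon>) S T x\<close> at time \<open>T\<close>; the two controls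
  have disjoint supports, so their energies add up.\<close>

lemma steered_with_detour:
  assumes T: "T > 0" and u: "steers T x u" "energy u \<le> ennreal E" and E: "E \<ge> 0"
    and e: "steered_with e (complex_of_real (1 - \<epsilon>) *\<^sub>C S T x)"
  shows "steered_with (\<epsilon>\<^sup>2 * E + e) x"
proof -
  let ?z = "complex_of_real (1 - \<epsilon>) *\<^sub>C x"
  from e T have "steered_with e (S T ?z)" by (simp add: scaleC)
  then obtain T' w where T': "T' > 0" and w: "steers T' (S T ?z) w" "energy w \<le> ennreal e" and e0: "e \<ge> 0"
    by (auto simp: steered_with_def)
  define R where "R = T' + T"
  have R: "R > 0" using T T' by (simp add: R_def)
  have u': "steers R x u" by (rule steers_mono[OF T _ u(1)]) (use T' in \<open>simp add: R_def\<close>)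
  have w': "steers R ?z (shift T w)"
    unfolding R_def using steers_shift[OF T' less_imp_le[OF T] w(1)] .
  have L2: "u \<in> L2_loc" "shift T w \<in> L2_loc" using u' w' by (simp_all add: steers_iff[OF R])
  let ?c = "\<lambda>t. complex_of_real \<epsilon> *\<^sub>C u t + 1 *\<^sub>C shift T w t"
  \<comment> \<open>Superposition: \<epsilon> u takes care of \<epsilon> x and the delayed
    \<open>w\<close> of (1 - \<epsilon>) x.\<close>
  have "complex_of_real \<epsilon> *\<^sub>C x + 1 *\<^sub>C ?z = x"
    by (simp add: scaleC_add_left[symmetric])
  with steers_linear_combination[OF R u' w', of "complex_of_real \<epsilon>" 1]
  have "steers R x ?c" by simp
  moreover have "energy ?c \<le> ennreal (\<epsilon>\<^sup>2 * E + e)"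
  proof -
    have "AE t in lebesgue. 0 \<le> t \<longrightarrow> t > T \<longrightarrow> u t = 0"
      using u(1) by (simp add: steers_iff[OF T] supported_in_iff)
    \<comment> \<open>At t = T both controls may be nonzero: \<open>u\<close> vanishes only after
      \<open>T\<close>, the delayed one only before.\<close>
    moreover have "AE t in lebesgue. t \<noteq> T"
      using AE_completion[OF AE_lborel_singleton] .
    ultimately have "AE t in lebesgue. 0 \<le> t \<longrightarrow> (norm (?c t))\<^sup>2 \<le> \<epsilon>\<^sup>2 * (norm (u t))\<^sup>2 + 1 * (norm (shift T w t))\<^sup>2"
    proof eventually_elim
      case (elim t)
      then show ?case
        by (cases "t < T") (auto simp: shift_def norm_scaleC power_mult_distrib)
    qed
    then have "energy ?c \<le> ennreal (\<epsilon>\<^sup>2) * energy u + ennreal 1 * energy (shift T w)"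
      by (intro energy_combination_le L2) (auto simp: AE_restrict_space_iff)
    also have "energy (shift T w) = energy w"
      using w(1) T by (intro energy_shift) (auto simp: steers_iff[OF T'])
    also have "ennreal (\<epsilon>\<^sup>2) * energy u + ennreal 1 * energy w \<le> ennreal (\<epsilon>\<^sup>2) * ennreal E + ennreal 1 * ennreal e"
      by (intro add_mono mult_left_mono u(2) w(2)) auto
    also have "\<dots> = ennreal (\<epsilon>\<^sup>2 * E + e)" using E e0 by (simp add: ennreal_mult)
    finally show ?thesis .
  qed
  ultimately show ?thesis using R E e0 unfolding steered_with_def by (intro conjI) auto
qed

text \<open>A real infimum, meaningful once the set is nonempty; null controllability guarantees
  this, so its properties are proved in the next locale.\<close>

definition cost :: "'h \<Rightarrow> real" where
  "cost x = Inf {e. steered_with e x}"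

end

locale null_controllable_system = control_system S A j Se B
  for S :: "real \<Rightarrow> 'h::complex_hilbert \<Rightarrow> 'h" and A :: "'h op_graph"
    and j :: "'d::complex_hilbert \<Rightarrow> 'h" and Se :: "real \<Rightarrow> 'd antidual \<Rightarrow> 'd antidual"
    and B :: "'u::complex_hilbert \<Rightarrow> 'd antidual" +
  fixes \<tau> :: real
  assumes \<tau>: "\<tau> > 0" and null_controllable: "null_controllable S j Se B \<tau>"
begin

text \<open>Source of two facts: the set defining \<open>cost\<close> is nonempty, and
  \<open>cost\<close> is continuous at 0.\<close>

lemma cost_bound: "\<exists>C\<ge>0. \<forall>x. steered_with (C * (norm x)\<^sup>2) x"
  using null_controllable_bounded_energy[OF \<tau> null_controllable] \<tau>
  unfolding steered_with_def by (metis mult_nonneg_nonneg zero_le_power2)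

lemma steered_with_nonempty: "{e. steered_with e x} \<noteq> {}"
  using cost_bound by blast

lemma steered_with_bdd_below: "bdd_below {e. steered_with e x}"
  by (rule bdd_belowI[of _ 0]) (simp add: steered_with_def)

lemma cost_nonneg: "cost x \<ge> 0"
  unfolding cost_def by (rule cInf_greatest[OF steered_with_nonempty]) (simp add: steered_with_def)

lemma cost_le: "steered_with e x \<Longrightarrow> cost x \<le> e"
  unfolding cost_def by (rule cInf_lower[OF _ steered_with_bdd_below]) simp

lemma steered_with_mono: "steered_with e x \<Longrightarrow> e \<le> f \<Longrightarrow> steered_with f x"
  unfolding steered_with_def by (meson ennreal_leI order_trans)

lemma cost_less_imp: "cost x < e \<Longrightarrow> steered_with e x"
  unfolding cost_def cInf_less_iff[OF steered_with_nonempty steered_with_bdd_below]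
  by (auto intro: steered_with_mono)

lemma cost_le_orbit: "t \<ge> 0 \<Longrightarrow> cost x \<le> cost (S t x)"
  by (rule dense_ge) (auto intro!: cost_le dest: cost_less_imp intro: steered_with_shift)

text \<open>Stands in for the triangle inequality of the square root of \<open>cost\<close>.\<close>

lemma cost_add_le:
  assumes \<delta>: "\<delta> > 0"
  shows "cost (x + y) \<le> (1 + \<delta>) * cost x + (1 + 1 / \<delta>) * cost y"
proof (rule field_le_epsilon)
  fix \<epsilon> :: real assume \<epsilon>: "\<epsilon> > 0"
  \<comment> \<open>Both costs are raised by \<eta>, and their coefficients sum to 2 + \<delta> +
    1/\<delta>.\<close>
  define \<eta> where "\<eta> = \<epsilon> / (2 + \<delta> + 1 / \<delta>)"
  have pos: "2 + \<delta> + 1 / \<delta> > 0" using \<delta> by (simp add: add_pos_pos)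
  then have \<eta>: "\<eta> > 0" using \<epsilon> by (simp add: \<eta>_def)
  have "cost (x + y) \<le> (1 + \<delta>) * (cost x + \<eta>) + (1 + 1 / \<delta>) * (cost y + \<eta>)"
    using \<eta> by (intro cost_le steered_with_add cost_less_imp \<delta>) auto
  also have "\<dots> = (1 + \<delta>) * cost x + (1 + 1 / \<delta>) * cost y + \<eta> * (2 + \<delta> + 1 / \<delta>)"
    by (simp add: algebra_simps)
  also have "\<eta> * (2 + \<delta> + 1 / \<delta>) = \<epsilon>" using pos by (simp add: \<eta>_def)
  finally show "cost (x + y) \<le> (1 + \<delta>) * cost x + (1 + 1 / \<delta>) * cost y + \<epsilon>" .
qed

lemma cost_scaleC_le: "cost (c *\<^sub>C x) \<le> (cmod c)\<^sup>2 * cost x"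
proof (cases "c = 0")
  case True
  obtain e where "steered_with e x" using steered_with_nonempty by blast
  from cost_le[OF steered_with_scaleC[OF this, of c]] True show ?thesis by simp
next
  case False
  show ?thesis
  proof (rule field_le_epsilon)
    fix \<epsilon> :: real assume \<epsilon>: "\<epsilon> > 0"
    have "cost (c *\<^sub>C x) \<le> (cmod c)\<^sup>2 * (cost x + \<epsilon> / (cmod c)\<^sup>2)"
      using \<epsilon> False by (intro cost_le steered_with_scaleC cost_less_imp) simp
    then show "cost (c *\<^sub>C x) \<le> (cmod c)\<^sup>2 * cost x + \<epsilon>"
      using False by (simp add: distrib_left)
  qed
qed

section \<open>The null space of the cost\<close>

definition null_cost :: "'h set" where
  "null_cost = {x. cost x = 0}"

lemma null_costI: "cost x \<le> 0 \<Longrightarrow> x \<in> null_cost"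
  using cost_nonneg[of x] by (simp add: null_cost_def)

lemma csubspace_null_cost: "csubspace null_cost"
  unfolding csubspace_def
proof (intro conjI ballI allI)
  show "0 \<in> null_cost" using cost_scaleC_le[of 0 0] by (intro null_costI) simp
next
  fix x y assume "x \<in> null_cost" "y \<in> null_cost"
  then show "x + y \<in> null_cost"
    using cost_add_le[of 1 x y] by (intro null_costI) (simp add: null_cost_def)
next
  fix c x assume "x \<in> null_cost"
  then show "c *\<^sub>C x \<in> null_cost"
    using cost_scaleC_le[of c x] by (intro null_costI) (simp add: null_cost_def)
qed

lemma cost_tendsto_zero: "(f \<longlongrightarrow> 0) F \<Longrightarrow> ((\<lambda>t. cost (f t)) \<longlongrightarrow> 0) F"
proof -
  assume f: "(f \<longlongrightarrow> 0) F"
  obtain C where C: "\<And>x. steered_with (C * (norm x)\<^sup>2) x" using cost_bound by blast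
  have "((\<lambda>t. C * (norm (f t))\<^sup>2) \<longlongrightarrow> C * (norm (0::'h))\<^sup>2) F"
    using f by (intro tendsto_intros)
  then have "((\<lambda>t. C * (norm (f t))\<^sup>2) \<longlongrightarrow> 0) F" by simp
  then show ?thesis
    by (rule Lim_null_comparison[rotated]) (auto intro!: always_eventually cost_le C simp: cost_nonneg)
qed

text \<open>For \<delta> = 1 the element \<open>f n\<close> contributes nothing, so
  \<open>cost x\<close> is at most twice the cost of x - f n, which tends to 0.\<close>

lemma closed_null_cost: "closed null_cost"
  unfolding closed_sequential_limits
proof (intro allI impI, elim conjE)
  fix f x assume f: "\<forall>n. f n \<in> null_cost" "f \<longlonglongrightarrow> x"
  have "(\<lambda>n. cost (x - f n)) \<longlonglongrightarrow> 0"
    using tendsto_diff[OF tendsto_const[of x] f(2)] by (intro cost_tendsto_zero) simp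
  then have lim: "(\<lambda>n. 2 * cost (x - f n)) \<longlonglongrightarrow> 0" by (rule tendsto_mult_right_zero)
  have "cost x \<le> 2 * cost (x - f n)" for n
    using cost_add_le[of 1 "x - f n" "f n"] f(1) by (simp add: null_cost_def)
  then have "cost x \<le> 0" by (intro LIMSEQ_le_const[OF lim] exI allI impI)
  then show "x \<in> null_cost" by (rule null_costI)
qed

text \<open>The contribution of \<open>n\<close> vanishes whatever its coefficient 1 + 1/\<delta>,
  so \<delta> may be arbitrarily small. The 1 in the denominator of \<delta> avoids division by a
  vanishing cost.\<close>

lemma cost_add_null_le:
  assumes "n \<in> null_cost"
  shows "cost (x + n) \<le> cost x"
proof (rule field_le_epsilon)
  fix \<epsilon> :: real assume \<epsilon>: "\<epsilon> > 0"
  define \<delta> where "\<delta> = \<epsilon> / (1 + cost x)"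
  have pos: "1 + cost x > 0" using cost_nonneg[of x] by simp
  have \<delta>: "\<delta> > 0" using \<epsilon> pos by (simp add: \<delta>_def)
  have "cost (x + n) \<le> cost x + \<delta> * cost x"
    using cost_add_le[OF \<delta>, of x n] assms by (simp add: null_cost_def algebra_simps)
  also have "\<dots> \<le> cost x + \<delta> * (1 + cost x)" using \<delta> by (simp add: algebra_simps)
  also have "\<delta> * (1 + cost x) = \<epsilon>" using pos by (simp add: \<delta>_def)
  finally show "cost (x + n) \<le> cost x + \<epsilon>" .
qed

lemma stable_imp_null_cost:
  assumes "((\<lambda>t. S t x) \<longlongrightarrow> 0) at_top"
  shows "x \<in> null_cost"
proof (rule null_costI)
  have "\<forall>\<^sub>F t in at_top. cost x \<le> cost (S t x)"
    using eventually_ge_at_top[of 0] by eventually_elim (rule cost_le_orbit)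
  with cost_tendsto_zero[OF assms] show "cost x \<le> 0"
    by (rule tendsto_lowerbound) simp
qed

text \<open>If moving along the free orbit does not increase the cost, spending a fraction \<open>\<epsilon>\<close> of
  the control gives \<open>cost x \<le> \<epsilon>\<^sup>2 E + (1 - \<epsilon>)\<^sup>2 cost x\<close> for all \<open>\<epsilon>\<close>, that is,
  \<open>cost x \<le> \<epsilon> E / (2 - \<epsilon>)\<close>.\<close>

lemma nonincreasing_cost_imp_null_cost:
  assumes le: "cost (S \<tau> x) \<le> cost x"
  shows "x \<in> null_cost"
proof (rule null_costI)
  obtain C where C: "C \<ge> 0" "\<And>x. \<exists>u. steers \<tau> x u \<and> energy u \<le> ennreal (C * (norm x)\<^sup>2)"
    using null_controllable_bounded_energy[OF \<tau> null_controllable] by blast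
  define E where "E = C * (norm x)\<^sup>2"
  have E: "E \<ge> 0" using C by (simp add: E_def)
  obtain u where u: "steers \<tau> x u" "energy u \<le> ennreal E" using C(2) unfolding E_def by blast
  have step: "cost x \<le> \<epsilon>\<^sup>2 * E + (1 - \<epsilon>)\<^sup>2 * cost x" for \<epsilon>
  proof (rule field_le_epsilon)
    fix \<eta> :: real assume \<eta>: "\<eta> > 0"
    have "cost x \<le> \<epsilon>\<^sup>2 * E + (cost (complex_of_real (1 - \<epsilon>) *\<^sub>C S \<tau> x) + \<eta>)"
      using \<eta> by (intro cost_le steered_with_detour[OF \<tau> u E] cost_less_imp) simp
    also have "cost (complex_of_real (1 - \<epsilon>) *\<^sub>C S \<tau> x) \<le> (1 - \<epsilon>)\<^sup>2 * cost (S \<tau> x)"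
      using cost_scaleC_le[of "complex_of_real (1 - \<epsilon>)" "S \<tau> x"] by (simp only: norm_of_real power2_abs)
    also have "\<dots> \<le> (1 - \<epsilon>)\<^sup>2 * cost x" by (intro mult_left_mono le) simp
    finally show "cost x \<le> \<epsilon>\<^sup>2 * E + (1 - \<epsilon>)\<^sup>2 * cost x + \<eta>" by simp
  qed
  have "cost x \<le> \<epsilon> * E" if \<epsilon>: "0 < \<epsilon>" "\<epsilon> < 1" for \<epsilon>
  proof -
    \<comment> \<open>Since 1 - (1 - \<epsilon>)^2 = \<epsilon> (2 - \<epsilon>), a factor
      \<epsilon> can be cancelled.\<close>
    have "\<epsilon> * ((2 - \<epsilon>) * cost x) \<le> \<epsilon> * (\<epsilon> * E)"
      using step[of \<epsilon>] by (simp add: power2_eq_square algebra_simps)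
    then have "(2 - \<epsilon>) * cost x \<le> \<epsilon> * E" using \<epsilon> by simp
    moreover have "1 * cost x \<le> (2 - \<epsilon>) * cost x" using \<epsilon> cost_nonneg by (intro mult_right_mono) auto
    ultimately show ?thesis by simp
  qed
  then have "\<forall>\<^sub>F \<epsilon> in at_right 0. cost x \<le> \<epsilon> * E"
    using eventually_at_right_real[of 0 1] by (auto elim: eventually_mono)
  moreover have "((\<lambda>\<epsilon>. \<epsilon> * E) \<longlongrightarrow> 0) (at_right 0)" by (intro tendsto_mult_left_zero tendsto_ident_at)
  ultimately show "cost x \<le> 0" by (intro tendsto_lowerbound) auto
qed

lemma generalized_eigenvector_null_cost:
  assumes gen: "generator S = A" and \<mu>: "Re \<mu> \<le> 0" and x: "(x, 0) \<in> shifted_op \<mu> A ^^ k"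
  shows "x \<in> null_cost"
  using x
proof (induction k arbitrary: x)
  case 0
  \<comment> \<open>The zeroth relational power is the identity, so x = 0.\<close>
  then show ?case using csubspace_null_cost by (simp add: csubspace_def)
next
  case (Suc k)
  \<comment> \<open>Since \<open>S t\<close> commutes with the shifted operator, the kernels of its
    powers are invariant. This extends the induction hypothesis from \<open>w\<close> to its orbit,
    as \<open>semigroup_modulo_subspace\<close> demands.\<close>
  have inv: "(S t y, S t z) \<in> shifted_op \<mu> A ^^ n" if "t \<ge> 0" "(y, z) \<in> shifted_op \<mu> A ^^ n" for t y z n
    using that(2)
  proof (induction n arbitrary: z)
    case (Suc n)
    then obtain w where w: "(S t y, S t w) \<in> shifted_op \<mu> A ^^ n" "(w, z) \<in> shifted_op \<mu> A"
      by (auto elim: relpow_Suc_E)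
    then obtain v where v: "(w, v) \<in> generator S" "z = \<mu> *\<^sub>C w - v" by (auto simp: shifted_op_def gen)
    from generator_invariant[OF that(1) v(1)] have "(S t w, S t z) \<in> shifted_op \<mu> A"
      using that(1) v(2) by (auto simp: shifted_op_def gen diff scaleC)
    with w(1) show ?case by auto
  qed simp
  from relpow_Suc_E2[OF Suc.prems] obtain w where w: "(x, w) \<in> shifted_op \<mu> A" "(w, 0) \<in> shifted_op \<mu> A ^^ k"
    by metis
  then obtain y where y: "(x, y) \<in> generator S" "w = \<mu> *\<^sub>C x - y" by (auto simp: shifted_op_def gen)
  have "S s w \<in> null_cost" if "s \<ge> 0" for s
    using inv[OF that w(2)] by (intro Suc.IH) (simp add: zero that)
  then have "S \<tau> x - exp (\<mu> * of_real \<tau>) *\<^sub>C x \<in> null_cost"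
    using y(2) by (intro semigroup_modulo_subspace[OF csubspace_null_cost closed_null_cost \<mu> y(1) _ \<tau>]) simp
  from cost_add_null_le[OF this, of "exp (\<mu> * of_real \<tau>) *\<^sub>C x"]
  have "cost (S \<tau> x) \<le> cost (exp (\<mu> * of_real \<tau>) *\<^sub>C x)" by simp
  also have "\<dots> \<le> (cmod (exp (\<mu> * of_real \<tau>)))\<^sup>2 * cost x" by (rule cost_scaleC_le)
  also have "\<dots> \<le> 1 * cost x"
    using \<mu> \<tau> by (intro mult_right_mono cost_nonneg power_le_one) (auto simp: mult_nonpos_nonneg)
  finally show ?case by (intro nonincreasing_cost_imp_null_cost) simp
qed

lemma null_cost_imp_NCVE_element:
  assumes "x \<in> null_cost"
  shows "NCVE_element S j Se B x"
  unfolding NCVE_element_def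
proof (intro conjI allI impI)
  show "\<exists>T>0. \<exists>u. steers T x u"
    using \<tau> null_controllable by (auto simp: null_controllable_def)
  fix \<epsilon> :: real assume "\<epsilon> > 0"
  with assms have "steered_with (\<epsilon>\<^sup>2) x" by (intro cost_less_imp) (simp add: null_cost_def)
  then show "\<exists>T>0. \<exists>u. steers T x u \<and> energy u \<le> ennreal (\<epsilon>\<^sup>2)" by (simp add: steered_with_def)
qed

end

text \<open>A linear inverse sends 0 to 0, whereas the converse of the shifted graph relates 0 to an
  eigenvector.\<close>

lemma eigenvalue_in_spectrum:
  assumes "eigenvalue A \<mu>"
  shows "\<mu> \<in> spectrum A"
proof -
  from assms obtain x where x: "(x, 0) \<in> shifted_op \<mu> A" "x \<noteq> 0" by (auto simp: eigenvalue_def op_ker_def)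
  have False if "\<mu> \<in> resolvent_set A"
  proof -
    from that obtain R where R: "bounded_clinear R" "(shifted_op \<mu> A)\<inverse> = {(y, R y) | y. True}"
      by (auto simp: resolvent_set_def)
    from x(1) have "(0, x) \<in> (shifted_op \<mu> A)\<inverse>" by simp
    then have "x = R 0" unfolding R(2) by simp
    with R(1) x(2) show False by (simp add: bounded_clinear_def linear_simps)
  qed
  then show ?thesis by (auto simp: spectrum_def)
qed

lemma eigenvalue_Re_le_spectral_bound: "eigenvalue A \<mu> \<Longrightarrow> ereal (Re \<mu>) \<le> spectral_bound A"
  unfolding spectral_bound_def by (intro SUP_upper eigenvalue_in_spectrum)

theorem theorem1p7:
  fixes A :: "'h::complex_hilbert op_graph"
    and S :: "real \<Rightarrow> 'h \<Rightarrow> 'h"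
    and j :: "'d::complex_hilbert \<Rightarrow> 'h"
    and Se :: "real \<Rightarrow> 'd antidual \<Rightarrow> 'd antidual"
    and B :: "'u::complex_hilbert \<Rightarrow> 'd antidual"
    and Hs H1 :: "'h set"
  assumes "generates A S"
    and "is_graph_space (adjoint_op A) j"
    and "generates (extended_op A j) Se"
    and "bounded_clinear B"
    and "\<And>T. T > 0 \<Longrightarrow> L_continuous j Se B T"
    and "csubspace Hs" and "closed Hs"
    and "csubspace H1" and "closed H1"
    and "is_direct_sum Hs H1"
    and "\<And>x. x \<in> Hs \<Longrightarrow> ((\<lambda>t. S t x) \<longlongrightarrow> 0) at_top"
    and "\<And>t x. t \<ge> 0 \<Longrightarrow> x \<in> H1 \<Longrightarrow> S t x \<in> H1"
    and "closure (cspan (generalized_eigenvectors A \<inter> H1)) = H1"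
    and "spectral_bound A \<le> 0"
    and "\<exists>T>0. null_controllable S j Se B T"
  shows "NCVE S j Se B"
proof -
  from assms(15) obtain \<tau> where \<tau>: "\<tau> > 0" "null_controllable S j Se B \<tau>" by blast
  interpret null_controllable_system S A j Se B \<tau>
    using assms(1-5) \<tau> by unfold_locales (auto simp: generates_def)
  have Hs: "Hs \<subseteq> null_cost" using assms(11) by (auto intro: stable_imp_null_cost)
  have "generalized_eigenvectors A \<subseteq> null_cost"
  proof
    fix x assume "x \<in> generalized_eigenvectors A"
    then obtain \<mu> k where \<mu>: "eigenvalue A \<mu>" and x: "(x, 0) \<in> shifted_op \<mu> A ^^ k"
      by (auto simp: generalized_eigenvectors_def op_ker_def)
    have "ereal (Re \<mu>) \<le> 0" using eigenvalue_Re_le_spectral_bound[OF \<mu>] assms(14) by (rule order_trans)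
    then have "Re \<mu> \<le> 0" by simp
    moreover have "generator S = A" using assms(1) by (simp add: generates_def)
    ultimately show "x \<in> null_cost" using x by (intro generalized_eigenvector_null_cost)
  qed
  then have "cspan (generalized_eigenvectors A \<inter> H1) \<subseteq> null_cost"
    unfolding cspan_def by (intro hull_minimal csubspace_null_cost) auto
  then have H1: "H1 \<subseteq> null_cost"
    using closure_minimal[OF _ closed_null_cost] assms(13) by blast
  have "x \<in> null_cost" for x
  proof -
    from assms(10) obtain v w where "v \<in> Hs" "w \<in> H1" "x = v + w"
      unfolding is_direct_sum_def by blast
    with Hs H1 csubspace_null_cost show ?thesis by (auto simp: csubspace_def)
  qed
  then show ?thesis by (simp add: NCVE_def null_cost_imp_NCVE_element)
qed

end
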